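(* Let $\alpha$ be an integer with $\alpha\notin\{0,1,2\}$ and $v_2(\alpha-1)=1$, and let $J$ be the Sylow $2$-subgroup of the Macdonald group $G(\alpha)$, with elements $A,B,C\in J$ as defined in the context. Then $J$ is isomorphic to the generalized quaternion group of order $16$, $Z(J)=\langle A^2\rangle=\gamma_3(J)$, $Z_2(J)=\langle A^2,C\rangle=\gamma_2(J)$, the nilpotency class of $J$ is $3$, and the exponent of $J$ is $8$.
   Context: For elements $a,b$ of a group, $[a,b]=a^{-1}b^{-1}ab$ and $b^a=a^{-1}ba$. For a group $T$, $Z_0(T)=1$ and $Z_{i+1}(T)/Z_i(T)$ is the center of $T/Z_i(T)$; $\gamma_1(T)=T$ and $\gamma_{i+1}(T)=[T,\gamma_i(T)]$. The Macdonald group is $G(\alpha)=\langle A,B\mid A^{[A,B]}=A^\alpha,\ B^{[B,A]}=B^\alpha\rangle$; for $\alpha\notin\{0,1,2\}$ it is finite and nilpotent, hence the direct product of its Sylow subgroups. By abuse of notation $A,B\in J$ denote the images of the two generators of $G(\alpha)$ under the projection $G(\alpha)\to J$ (so $A,B$ generate $J$), and $C=[A,B]\in J$. $v_2$ denotes the $2$-adic valuation. *)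

theory Defs
  imports "HOL-Algebra.Sylow" "HOL-Algebra.Generated_Groups"
begin

section \<open>Group presentations\<close>

text \<open>A word over the generators \<open>'g\<close>; the letter \<open>(x, True)\<close> stands for \<open>x\<close> and \<open>(x, False)\<close>
  for the formal inverse of \<open>x\<close>.\<close>

type_synonym 'g word = "('g \<times> bool) list"

definition word_inv :: "'g word \<Rightarrow> 'g word"
  where "word_inv w = rev (map (\<lambda>(x, s). (x, \<not> s)) w)"

definition word_pow :: "'g word \<Rightarrow> int \<Rightarrow> 'g word"
  where "word_pow w k =
    (if 0 \<le> k then concat (replicate (nat k) w) else concat (replicate (nat (- k)) (word_inv w)))"

definition word_conj :: "'g word \<Rightarrow> 'g word \<Rightarrow> 'g word"
  where "word_conj u v = word_inv v @ u @ v"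

definition word_comm :: "'g word \<Rightarrow> 'g word \<Rightarrow> 'g word"
  where "word_comm u v = word_inv u @ word_inv v @ u @ v"

text \<open>A set \<open>R\<close> of pairs of words is a set of defining relations \<open>u = v\<close>. Two words represent
  the same element of the presented group iff they are related by the smallest congruence on words
  that contains \<open>R\<close> and the cancellation of a letter against its inverse.\<close>

inductive_set pres_cong :: "('g word \<times> 'g word) set \<Rightarrow> ('g word \<times> 'g word) set"
  for R :: "('g word \<times> 'g word) set"
  where
    rel: "(u, v) \<in> R \<Longrightarrow> (u, v) \<in> pres_cong R"
  | cancel: "([(x, s), (x, \<not> s)], []) \<in> pres_cong R"
  | refl: "(u, u) \<in> pres_cong R"
  | sym: "(u, v) \<in> pres_cong R \<Longrightarrow> (v, u) \<in> pres_cong R"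
  | trans: "(u, v) \<in> pres_cong R \<Longrightarrow> (v, w) \<in> pres_cong R \<Longrightarrow> (u, w) \<in> pres_cong R"
  | append: "(u, u') \<in> pres_cong R \<Longrightarrow> (v, v') \<in> pres_cong R \<Longrightarrow> (u @ v, u' @ v') \<in> pres_cong R"

definition pres_class :: "('g word \<times> 'g word) set \<Rightarrow> 'g word \<Rightarrow> 'g word set"
  where "pres_class R w = pres_cong R `` {w}"

definition presented_group :: "('g word \<times> 'g word) set \<Rightarrow> 'g word set monoid"
  where "presented_group R =
    \<lparr>carrier = UNIV // pres_cong R,
     monoid.mult = (\<lambda>X Y. \<Union>u\<in>X. \<Union>v\<in>Y. pres_class R (u @ v)),
     one = pres_class R []\<rparr>"

lemma equiv_pres_cong: "equiv UNIV (pres_cong R)"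
  by (rule equivI)
    (auto simp: refl_on_def sym_def trans_def intro: pres_cong.refl pres_cong.sym pres_cong.trans)

lemma pres_class_eq_iff: "pres_class R u = pres_class R v \<longleftrightarrow> (u, v) \<in> pres_cong R"
  unfolding pres_class_def by (simp add: eq_equiv_class_iff[OF equiv_pres_cong])

lemma carrier_presented_group: "carrier (presented_group R) = range (pres_class R)"
  by (auto simp: presented_group_def quotient_def pres_class_def)

lemma one_presented_group: "\<one>\<^bsub>presented_group R\<^esub> = pres_class R []"
  by (simp add: presented_group_def)

lemma mult_presented_group:
  "pres_class R u \<otimes>\<^bsub>presented_group R\<^esub> pres_class R v = pres_class R (u @ v)"
proof -
  have eq: "pres_class R (u' @ v') = pres_class R (u @ v)"
    if "u' \<in> pres_class R u" "v' \<in> pres_class R v" for u' v'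
  proof -
    from that have "(u, u') \<in> pres_cong R" "(v, v') \<in> pres_cong R"
      by (simp_all add: pres_class_def)
    then have "(u @ v, u' @ v') \<in> pres_cong R"
      by (rule pres_cong.append)
    then show ?thesis
      unfolding pres_class_eq_iff by (rule pres_cong.sym)
  qed
  have mem: "w \<in> pres_class R w" for w
    by (simp add: pres_class_def pres_cong.refl)
  have "(\<Union>u'\<in>pres_class R u. \<Union>v'\<in>pres_class R v. pres_class R (u' @ v'))
      = (\<Union>u'\<in>pres_class R u. \<Union>v'\<in>pres_class R v. pres_class R (u @ v))"
    by (intro SUP_cong HOL.refl eq)
  also have "\<dots> = pres_class R (u @ v)"
    using mem[of u] mem[of v] by blast
  finally show ?thesis
    by (simp add: presented_group_def)
qed

lemma word_inv_cancel: "(word_inv w @ w, []) \<in> pres_cong R"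
proof (induction w)
  case Nil
  show ?case by (simp add: word_inv_def pres_cong.refl)
next
  case (Cons l w)
  obtain x s where l: "l = (x, s)" by fastforce
  have "([(x, \<not> s), (x, s)] @ w, [] @ w) \<in> pres_cong R"
    using pres_cong.cancel[of x "\<not> s" R] by (intro pres_cong.append[OF _ pres_cong.refl]) simp
  then have "(word_inv w @ [(x, \<not> s), (x, s)] @ w, word_inv w @ [] @ w) \<in> pres_cong R"
    by (rule pres_cong.append[OF pres_cong.refl])
  moreover have "word_inv (l # w) @ l # w = word_inv w @ [(x, \<not> s), (x, s)] @ w"
    by (simp add: word_inv_def l)
  ultimately have "(word_inv (l # w) @ l # w, word_inv w @ w) \<in> pres_cong R"
    by (simp only: append_Nil)
  then show ?case
    using Cons.IH by (rule pres_cong.trans)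
qed

lemma group_presented_group: "group (presented_group R)"
proof (rule groupI)
  fix X assume "X \<in> carrier (presented_group R)"
  then obtain w where w: "X = pres_class R w"
    by (auto simp: carrier_presented_group)
  have "pres_class R (word_inv w) \<otimes>\<^bsub>presented_group R\<^esub> X = \<one>\<^bsub>presented_group R\<^esub>"
    by (simp add: w mult_presented_group one_presented_group pres_class_eq_iff word_inv_cancel)
  then show "\<exists>Y\<in>carrier (presented_group R). Y \<otimes>\<^bsub>presented_group R\<^esub> X = \<one>\<^bsub>presented_group R\<^esub>"
    by (auto simp: carrier_presented_group)
qed (auto simp: carrier_presented_group one_presented_group mult_presented_group)

lemma inv_presented_group: "inv\<^bsub>presented_group R\<^esub> (pres_class R w) = pres_class R (word_inv w)"
  by (rule group.inv_equality[OF group_presented_group])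
    (auto simp: carrier_presented_group one_presented_group mult_presented_group pres_class_eq_iff
      word_inv_cancel)

lemma int_pow_presented_group:
  "pres_class R w [^]\<^bsub>presented_group R\<^esub> (k::int) = pres_class R (word_pow w k)"
proof -
  interpret group "presented_group R" by (rule group_presented_group)
  have shift: "concat (replicate n v) @ v = v @ concat (replicate n v)" for v :: "'a word" and n
    by (induction n) simp_all
  have nat_pow: "pres_class R v [^]\<^bsub>presented_group R\<^esub> n = pres_class R (concat (replicate n v))"
    for v and n :: nat
    by (induction n) (simp_all add: one_presented_group mult_presented_group shift)
  show ?thesis
  proof (cases "0 \<le> k")
    case True
    then show ?thesis
      by (simp add: int_pow_def2 word_pow_def nat_pow)
  next
    case False
    then have "pres_class R w [^]\<^bsub>presented_group R\<^esub> k
        = inv\<^bsub>presented_group R\<^esub> (pres_class R w [^]\<^bsub>presented_group R\<^esub> nat (- k))"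
      by (simp only: int_pow_def2 not_le if_True)
    also have "\<dots> = (inv\<^bsub>presented_group R\<^esub> pres_class R w) [^]\<^bsub>presented_group R\<^esub> nat (- k)"
      by (rule nat_pow_inv[symmetric]) (simp add: carrier_presented_group)
    also have "\<dots> = pres_class R (word_pow w k)"
      using False by (simp only: inv_presented_group nat_pow word_pow_def if_False)
    finally show ?thesis .
  qed
qed


section \<open>Commutators, central series, class, exponent\<close>

definition commut :: "('a, 'b) monoid_scheme \<Rightarrow> 'a \<Rightarrow> 'a \<Rightarrow> 'a"
  where "commut G x y = inv\<^bsub>G\<^esub> x \<otimes>\<^bsub>G\<^esub> inv\<^bsub>G\<^esub> y \<otimes>\<^bsub>G\<^esub> x \<otimes>\<^bsub>G\<^esub> y"

definition center :: "('a, 'b) monoid_scheme \<Rightarrow> 'a set"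
  where "center G = {z \<in> carrier G. \<forall>x \<in> carrier G. z \<otimes>\<^bsub>G\<^esub> x = x \<otimes>\<^bsub>G\<^esub> z}"

primrec upper_central :: "('a, 'b) monoid_scheme \<Rightarrow> nat \<Rightarrow> 'a set"
  where
    "upper_central G 0 = {\<one>\<^bsub>G\<^esub>}"
  | "upper_central G (Suc i) =
      {x \<in> carrier G. upper_central G i #>\<^bsub>G\<^esub> x \<in> center (G Mod upper_central G i)}"

definition commut_subgroup :: "('a, 'b) monoid_scheme \<Rightarrow> 'a set \<Rightarrow> 'a set \<Rightarrow> 'a set"
  where "commut_subgroup G H K = generate G {commut G h k | h k. h \<in> H \<and> k \<in> K}"

text \<open>The lower central series starts at index 1; the value at 0 is a dummy.\<close>

fun lower_central :: "('a, 'b) monoid_scheme \<Rightarrow> nat \<Rightarrow> 'a set"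
  where
    "lower_central G 0 = carrier G"
  | "lower_central G (Suc 0) = carrier G"
  | "lower_central G (Suc (Suc i)) = commut_subgroup G (carrier G) (lower_central G (Suc i))"

definition nilpotent_of_class :: "('a, 'b) monoid_scheme \<Rightarrow> nat \<Rightarrow> bool"
  where "nilpotent_of_class G c \<longleftrightarrow>
    upper_central G c = carrier G \<and> (\<forall>i < c. upper_central G i \<noteq> carrier G)"

definition has_exponent :: "('a, 'b) monoid_scheme \<Rightarrow> nat \<Rightarrow> bool"
  where "has_exponent G e \<longleftrightarrow>
    0 < e \<and> (\<forall>x \<in> carrier G. x [^]\<^bsub>G\<^esub> e = \<one>\<^bsub>G\<^esub>) \<and>
    (\<forall>n. 0 < n \<and> (\<forall>x \<in> carrier G. x [^]\<^bsub>G\<^esub> n = \<one>\<^bsub>G\<^esub>) \<longrightarrow> e \<le> n)"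


section \<open>Sylow subgroups and projections onto them\<close>

text \<open>Intended for finite \<open>G\<close>. Note that \<open>order G = 0\<close> for infinite \<open>G\<close>, and then
  only the trivial subgroup qualifies.\<close>

definition sylow_subgroup :: "nat \<Rightarrow> ('a, 'b) monoid_scheme \<Rightarrow> 'a set \<Rightarrow> bool"
  where "sylow_subgroup p G P \<longleftrightarrow>
    prime p \<and> subgroup P G \<and> card P = p ^ multiplicity p (order G)"

text \<open>If \<open>G\<close> is the direct product of its Sylow subgroups, the projection onto the factor \<open>P\<close> is
  the homomorphism that is the identity on \<open>P\<close> and trivial on all the other factors.\<close>

definition sylow_projection :: "nat \<Rightarrow> ('a, 'b) monoid_scheme \<Rightarrow> 'a set \<Rightarrow> ('a \<Rightarrow> 'a) \<Rightarrow> bool"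
  where "sylow_projection p G P \<pi> \<longleftrightarrow>
    \<pi> \<in> hom G (G\<lparr>carrier := P\<rparr>) \<and>
    (\<forall>x \<in> P. \<pi> x = x) \<and>
    (\<forall>q Q. q \<noteq> p \<and> sylow_subgroup q G Q \<longrightarrow> (\<forall>x \<in> Q. \<pi> x = \<one>\<^bsub>G\<^esub>))"


section \<open>The Macdonald groups and the generalized quaternion groups\<close>

datatype gen = GenA | GenB

abbreviation wA :: "gen word" where "wA \<equiv> [(GenA, True)]"
abbreviation wB :: "gen word" where "wB \<equiv> [(GenB, True)]"

definition macdonald_rels :: "int \<Rightarrow> (gen word \<times> gen word) set"
  where "macdonald_rels \<alpha> =
    {(word_conj wA (word_comm wA wB), word_pow wA \<alpha>),
     (word_conj wB (word_comm wB wA), word_pow wB \<alpha>)}"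

definition macdonald_group :: "int \<Rightarrow> gen word set monoid"
  where "macdonald_group \<alpha> = presented_group (macdonald_rels \<alpha>)"

definition macdonald_A :: "int \<Rightarrow> gen word set"
  where "macdonald_A \<alpha> = pres_class (macdonald_rels \<alpha>) wA"

definition macdonald_B :: "int \<Rightarrow> gen word set"
  where "macdonald_B \<alpha> = pres_class (macdonald_rels \<alpha>) wB"

text \<open>For \<open>n \<ge> 3\<close>, the generalized quaternion group of order \<open>2 ^ n\<close>, presented as
  \<open>\<langle>a, b | a^(2^(n-1)) = 1, b^2 = a^(2^(n-2)), b^(-1) a b = a^(-1)\<rangle>\<close>.\<close>

definition generalized_quaternion_group :: "nat \<Rightarrow> gen word set monoid"
  where "generalized_quaternion_group n = presented_group
    {(word_pow wA (2 ^ (n - 1)), []),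
     (word_pow wB 2, word_pow wA (2 ^ (n - 2))),
     (word_conj wA wB, word_inv wA)}"

lemma macdonald_relations:
  fixes \<alpha> :: int
  defines "G \<equiv> macdonald_group \<alpha>" and "A \<equiv> macdonald_A \<alpha>" and "B \<equiv> macdonald_B \<alpha>"
  shows "inv\<^bsub>G\<^esub> (commut G A B) \<otimes>\<^bsub>G\<^esub> A \<otimes>\<^bsub>G\<^esub> commut G A B = A [^]\<^bsub>G\<^esub> \<alpha>"
    and "inv\<^bsub>G\<^esub> (commut G B A) \<otimes>\<^bsub>G\<^esub> B \<otimes>\<^bsub>G\<^esub> commut G B A = B [^]\<^bsub>G\<^esub> \<alpha>"
  unfolding G_def A_def B_def macdonald_group_def macdonald_A_def macdonald_B_def commut_def
    inv_presented_group mult_presented_group int_pow_presented_group pres_class_eq_iff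
  by (rule pres_cong.rel; simp add: macdonald_rels_def word_conj_def word_comm_def)+

end

theory Submission
  imports Defs "HOL-Algebra.Multiplicative_Group"
begin

text \<open>
  Let s(n) (below: geo) be the sum of the powers of \<open>\<alpha>\<close> with exponents 1, ..., n. In any group with the
  Macdonald relations, \<open>A^n B = B C^n A^s(n)\<close>, and symmetrically for B. Hence every element is of
  the form \<open>B^i C^j A^k\<close>. Conjugating A by \<open>C B = B^\<alpha> C\<close> in two ways shows that \<open>B^u\<close> is a power
  of A for an explicit integer u. So \<open>A^u\<close> and \<open>B^u\<close> are central and have order dividing \<open>\<alpha> - 1\<close>,
  which makes the Macdonald group finite. If \<open>\<alpha> \<equiv> 3 (mod 4)\<close>, then \<open>u \<equiv> 2 (mod 4)\<close>, so in J we get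
  \<open>A^4 = 1\<close> and \<open>A^2 = B^2 = C^2\<close>; then \<open>a = B A^(-1)\<close> and \<open>b = A\<close> satisfy the quaternion relations,
  and J has order at most 16. Conversely, the quaternion group of order 16 is a quotient of the
  Macdonald group, so 16 divides the order of J.
\<close>

section \<open>Groups with the Macdonald relations\<close>

lemma (in group) inv_mult_cancel [simp]:
  assumes "x \<in> carrier G" "y \<in> carrier G"
  shows "inv x \<otimes> (x \<otimes> y) = y" "x \<otimes> (inv x \<otimes> y) = y"
  using assms by (simp_all flip: m_assoc)

lemma (in group) conj_int_pow:
  assumes "g \<in> carrier G" "x \<in> carrier G"
  shows "(inv g \<otimes> x \<otimes> g) [^] (n::int) = inv g \<otimes> x [^] n \<otimes> g"
proof -
  have "(\<lambda>x. inv g \<otimes> x \<otimes> g) \<in> hom G G"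
    using assms by (auto simp: hom_def m_assoc)
  from hom_int_pow[OF this] show ?thesis
    using assms is_group by simp
qed

lemma (in group) commut_closed [simp, intro]:
  "x \<in> carrier G \<Longrightarrow> y \<in> carrier G \<Longrightarrow> commut G x y \<in> carrier G"
  by (simp add: commut_def)

lemma (in group) inv_commut:
  "x \<in> carrier G \<Longrightarrow> y \<in> carrier G \<Longrightarrow> inv (commut G x y) = commut G y x"
  by (simp add: commut_def inv_mult_group m_assoc)

lemma (in group) commute_int_pow:
  assumes "x \<in> carrier G" "y \<in> carrier G" "x \<otimes> y = y \<otimes> x"
  shows "x \<otimes> y [^] (n::int) = y [^] n \<otimes> x"
proof -
  have "inv x \<otimes> y \<otimes> x = y"
    using assms by (simp add: m_assoc flip: assms(3))
  then have "inv x \<otimes> y [^] n \<otimes> x = y [^] n"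
    using conj_int_pow[OF assms(1,2), of n] by simp
  then have "x \<otimes> (inv x \<otimes> (y [^] n \<otimes> x)) = x \<otimes> y [^] n"
    using assms by (simp add: m_assoc)
  then show ?thesis
    using assms by simp
qed

primrec geo :: "int \<Rightarrow> nat \<Rightarrow> int" where
  "geo \<alpha> 0 = 0"
| "geo \<alpha> (Suc n) = \<alpha> * (geo \<alpha> n + 1)"

text \<open>The relations are separated from the presentation so that the same lemmas serve the
  Macdonald group itself and its Sylow 2-subgroup, and so that pairs in \<open>q16\<close> can be
  tested against them.\<close>

locale macdonald_pair = group G for G (structure) +
  fixes x y :: 'a and \<alpha> :: int
  assumes x [simp, intro]: "x \<in> carrier G" and y [simp, intro]: "y \<in> carrier G"
    and rel_x: "inv (commut G x y) \<otimes> x \<otimes> commut G x y = x [^] \<alpha>"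
    and rel_y: "inv (commut G y x) \<otimes> y \<otimes> commut G y x = y [^] \<alpha>"
begin

text \<open>The relations are symmetric in the two generators, and the exchange turns
  \<open>c\<close> into \<open>inv c\<close>. Every fact about \<open>x\<close> thus yields one
  about \<open>y\<close>.\<close>

lemma swap: "macdonald_pair G y x \<alpha>"
  by unfold_locales (simp_all add: rel_x rel_y)

abbreviation c where "c \<equiv> commut G x y"

lemma c [simp, intro]: "c \<in> carrier G"
  by simp

lemma commut_swap: "commut G y x = inv c"
  by (simp add: inv_commut)

lemma x_pow_c: "x [^] m \<otimes> c = c \<otimes> x [^] (\<alpha> * m)" for m :: int
proof -
  have "inv c \<otimes> x [^] m \<otimes> c = x [^] (\<alpha> * m)"
    using conj_int_pow[of c x m] by (simp add: rel_x int_pow_pow)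
  then have "c \<otimes> (inv c \<otimes> x [^] m \<otimes> c) = c \<otimes> x [^] (\<alpha> * m)"
    by simp
  then show ?thesis
    by (simp add: m_assoc)
qed

lemma c_y_pow: "c \<otimes> y [^] m = y [^] (\<alpha> * m) \<otimes> c" for m :: int
proof -
  interpret sw: macdonald_pair G y x \<alpha> by (rule swap)
  have "y [^] m \<otimes> inv c = inv c \<otimes> y [^] (\<alpha> * m)"
    using sw.x_pow_c[of m] by (simp add: commut_swap)
  then have "c \<otimes> (y [^] m \<otimes> inv c) \<otimes> c = c \<otimes> (inv c \<otimes> y [^] (\<alpha> * m)) \<otimes> c"
    by simp
  then show ?thesis
    by (simp add: m_assoc)
qed

lemma x_pow_c_pow: "x [^] m \<otimes> c [^] k = c [^] k \<otimes> x [^] (m * \<alpha> ^ k)" for m :: int and k :: nat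
proof (induction k arbitrary: m)
  case (Suc k)
  have "x [^] m \<otimes> c [^] Suc k = (x [^] m \<otimes> c [^] k) \<otimes> c"
    by (simp add: m_assoc)
  also have "\<dots> = c [^] k \<otimes> (x [^] (m * \<alpha> ^ k) \<otimes> c)"
    by (simp add: Suc m_assoc)
  also have "\<dots> = c [^] Suc k \<otimes> x [^] (m * \<alpha> ^ Suc k)"
    by (simp add: x_pow_c m_assoc mult_ac)
  finally show ?case .
qed simp

lemma c_pow_y_pow: "c [^] k \<otimes> y [^] m = y [^] (m * \<alpha> ^ k) \<otimes> c [^] k" for m :: int and k :: nat
proof (induction k arbitrary: m)
  case (Suc k)
  have "c [^] Suc k \<otimes> y [^] m = c [^] k \<otimes> (c \<otimes> y [^] m)"
    by (simp add: m_assoc)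
  also have "\<dots> = (c [^] k \<otimes> y [^] (\<alpha> * m)) \<otimes> c"
    by (simp add: c_y_pow m_assoc)
  also have "\<dots> = y [^] (m * \<alpha> ^ Suc k) \<otimes> c [^] Suc k"
    by (simp add: Suc m_assoc mult_ac)
  finally show ?case .
qed simp

text \<open>Collection formula: as \<open>x y = y x c\<close>, each further \<open>x\<close> leaves
  a factor \<open>x c\<close> behind \<open>y\<close>. Moving that \<open>c\<close> left past
  \<open>x^(geo \<alpha> n + 1)\<close> multiplies the exponent by \<alpha>, which is the recursion
  of \<open>geo\<close>.\<close>

lemma x_pow_y: "x [^] n \<otimes> y = y \<otimes> c [^] n \<otimes> x [^] geo \<alpha> n" for n :: nat
proof (induction n)
  case (Suc n)
  have xy: "x \<otimes> y = y \<otimes> (x \<otimes> c)"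
    by (simp add: commut_def m_assoc)
  have "x [^] Suc n \<otimes> y = (x [^] n \<otimes> y) \<otimes> (x \<otimes> c)"
    by (simp add: m_assoc xy)
  also have "\<dots> = y \<otimes> (c [^] n \<otimes> (x [^] geo \<alpha> n \<otimes> x [^] (1::int) \<otimes> c))"
    by (simp add: Suc m_assoc)
  also have "x [^] geo \<alpha> n \<otimes> x [^] (1::int) \<otimes> c = c \<otimes> x [^] geo \<alpha> (Suc n)"
    by (simp only: int_pow_mult[OF x, symmetric] x_pow_c geo.simps)
  finally show ?case
    by (simp add: m_assoc)
qed simp

lemma y_pow_x: "y [^] n \<otimes> x = x \<otimes> inv (c [^] n) \<otimes> y [^] geo \<alpha> n" for n :: nat
proof -
  interpret sw: macdonald_pair G y x \<alpha> by (rule swap)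
  show ?thesis
    using sw.x_pow_y[of n] by (simp add: commut_swap nat_pow_inv)
qed

section \<open>A common power of the two generators\<close>

definition "absn = nat \<bar>\<alpha>\<bar>"

text \<open>The exponent of \<open>y\<close> that arises in \<open>y_pow_u_conj\<close>. The
  collection formulas take natural exponents only, so a negative \<alpha> is reached through
  \<open>x^(- \<alpha>)\<close> and leads to a different expression.\<close>

definition u :: int where
  "u = (if \<alpha> \<ge> 0 then \<alpha> ^ Suc absn - geo \<alpha> absn else geo \<alpha> absn + \<alpha>)"

text \<open>Evaluate the conjugate of \<open>x\<close> by \<open>c y = y\<^sup>\<alpha> c\<close> in two ways.\<close>

lemma y_pow_u_conj: "y [^] u \<otimes> c [^] Suc absn = c [^] Suc absn \<otimes> x [^] (- u)"
proof -
  define n where "n = absn"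
  let ?s = "geo \<alpha> n"
  have cy: "c \<otimes> y = y [^] \<alpha> \<otimes> c"
    using c_y_pow[of 1] by simp
  have x\<alpha>: "c \<otimes> x [^] \<alpha> = x \<otimes> c"
    using x_pow_c[of 1] by simp
  show ?thesis
  proof (cases "\<alpha> \<ge> 0")
    case True
    then have \<alpha>: "\<alpha> = int n" by (simp add: n_def absn_def)
    have pw: "z [^] n = z [^] \<alpha>" for z by (simp add: \<alpha> int_pow_int)
    have yx: "y [^] \<alpha> \<otimes> x = x \<otimes> inv (c [^] n) \<otimes> y [^] ?s"
      using y_pow_x[of n] by (simp add: pw)
    \<comment> \<open>The element \<open>c x^\<alpha> y\<close> is rewritten twice: by collecting
      \<open>x^\<alpha> y\<close>, and by \<open>c x^\<alpha> = x c\<close> followed by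
      \<open>c y = y^\<alpha> c\<close>.\<close>
    have "x [^] \<alpha> \<otimes> y = y \<otimes> c [^] n \<otimes> x [^] ?s"
      using x_pow_y[of n] by (simp add: pw)
    then have "c \<otimes> (x [^] \<alpha> \<otimes> y) = c \<otimes> (y \<otimes> c [^] n \<otimes> x [^] ?s)"
      by simp
    moreover have "c \<otimes> (x [^] \<alpha> \<otimes> y) = x \<otimes> y [^] \<alpha> \<otimes> c"
      by (simp add: x\<alpha> cy m_assoc flip: m_assoc[of c "x [^] \<alpha>"])
    moreover have "c \<otimes> (y \<otimes> c [^] n \<otimes> x [^] ?s) = y [^] \<alpha> \<otimes> c [^] Suc n \<otimes> x [^] ?s"
      by (simp only: nat_pow_Suc2[OF c]) (simp add: cy m_assoc flip: m_assoc[of c y])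
    ultimately have eq: "x \<otimes> y [^] \<alpha> \<otimes> c = y [^] \<alpha> \<otimes> c [^] Suc n \<otimes> x [^] ?s"
      by simp
    have yx': "inv (y [^] \<alpha>) \<otimes> x = x \<otimes> inv (y [^] ?s) \<otimes> c [^] n"
    proof -
      have "inv (y [^] \<alpha>) \<otimes> (y [^] \<alpha> \<otimes> x) \<otimes> inv (y [^] ?s) \<otimes> c [^] n
          = inv (y [^] \<alpha>) \<otimes> (x \<otimes> inv (c [^] n) \<otimes> y [^] ?s) \<otimes> inv (y [^] ?s) \<otimes> c [^] n"
        by (simp only: yx)
      then show ?thesis by (simp add: m_assoc)
    qed
    \<comment> \<open>Cancelling \<open>y^\<alpha>\<close> on the left and carrying its inverse past
      \<open>x\<close> by \<open>yx'\<close> gathers the powers of \<open>y\<close> into one: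
      \<open>c^(n+1) x^s = x y^u c^(n+1)\<close>.\<close>
    have "c [^] Suc n \<otimes> x [^] ?s = inv (y [^] \<alpha>) \<otimes> (y [^] \<alpha> \<otimes> c [^] Suc n \<otimes> x [^] ?s)"
      by (simp add: m_assoc)
    also have "\<dots> = (inv (y [^] \<alpha>) \<otimes> x) \<otimes> y [^] \<alpha> \<otimes> c"
      by (simp only: eq[symmetric]) (simp add: m_assoc)
    also have "\<dots> = x \<otimes> inv (y [^] ?s) \<otimes> (c [^] n \<otimes> y [^] \<alpha>) \<otimes> c"
      by (simp only: yx') (simp add: m_assoc)
    also have "\<dots> = x \<otimes> (y [^] (- ?s) \<otimes> y [^] (\<alpha> ^ Suc n)) \<otimes> c [^] Suc n"
      by (simp add: c_pow_y_pow m_assoc int_pow_neg)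
    also have "y [^] (- ?s) \<otimes> y [^] (\<alpha> ^ Suc n) = y [^] u"
      using True by (simp add: u_def flip: n_def int_pow_mult)
    finally have "x [^] (-1::int) \<otimes> (c [^] Suc n \<otimes> x [^] ?s) = y [^] u \<otimes> c [^] Suc n"
      by (simp add: m_assoc int_pow_neg del: nat_pow_Suc)
    moreover have "x [^] (-1::int) \<otimes> (c [^] Suc n \<otimes> x [^] ?s) = c [^] Suc n \<otimes> (x [^] (- (\<alpha> ^ Suc n)) \<otimes> x [^] ?s)"
    proof -
      have "x [^] (-1::int) \<otimes> c [^] Suc n = c [^] Suc n \<otimes> x [^] (- (\<alpha> ^ Suc n))"
        using x_pow_c_pow[of "-1" "Suc n"] by simp
      then show ?thesis
        by (simp only: m_assoc[symmetric] x c int_pow_closed nat_pow_closed)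
    qed
    moreover have "x [^] (- (\<alpha> ^ Suc n)) \<otimes> x [^] ?s = x [^] (- u)"
      using True by (simp add: u_def flip: n_def int_pow_mult)
    ultimately show ?thesis
      by (simp add: n_def)
  next
    case False
    then have \<alpha>: "\<alpha> = - int n" by (simp add: n_def absn_def)
    have pw: "z [^] n = inv (z [^] \<alpha>)" if "z \<in> carrier G" for z
      using that by (simp add: \<alpha> int_pow_int int_pow_neg)
    \<comment> \<open>Now \<open>n = - \<alpha>\<close>, so the roles are reversed: the formula for
      \<open>y\<close> has the desired form at once, and the one for \<open>x\<close> must be solved
      for \<open>x^\<alpha> y\<close>.\<close>
    have yx: "inv (y [^] \<alpha>) \<otimes> x = x \<otimes> inv (c [^] n) \<otimes> y [^] ?s"
      using y_pow_x[of n] by (simp only: pw[OF y])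
    have xy: "inv (x [^] \<alpha>) \<otimes> y = y \<otimes> c [^] n \<otimes> x [^] ?s"
      using x_pow_y[of n] by (simp only: pw[OF x])
    have xy': "x [^] \<alpha> \<otimes> y = y \<otimes> x [^] (- ?s) \<otimes> inv (c [^] n)"
    proof -
      have "x [^] \<alpha> \<otimes> (y \<otimes> c [^] n \<otimes> x [^] ?s) \<otimes> inv (x [^] ?s) \<otimes> inv (c [^] n)
        = x [^] \<alpha> \<otimes> (inv (x [^] \<alpha>) \<otimes> y) \<otimes> inv (x [^] ?s) \<otimes> inv (c [^] n)"
        by (simp only: xy)
      then show ?thesis by (simp add: m_assoc int_pow_neg)
    qed
    have eq: "x \<otimes> y [^] \<alpha> \<otimes> c = y [^] \<alpha> \<otimes> c \<otimes> x [^] (- ?s) \<otimes> inv (c [^] n)"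
    proof -
      have "x \<otimes> y [^] \<alpha> \<otimes> c = c \<otimes> (x [^] \<alpha> \<otimes> y)"
        by (simp add: x\<alpha> cy m_assoc flip: m_assoc[of c "x [^] \<alpha>"])
      also have "\<dots> = c \<otimes> y \<otimes> (x [^] (- ?s) \<otimes> inv (c [^] n))"
        by (simp only: xy') (simp add: m_assoc)
      finally show ?thesis
        by (simp only: cy) (simp add: m_assoc)
    qed
    have "c \<otimes> x [^] (- ?s) \<otimes> inv (c [^] n) = inv (y [^] \<alpha>) \<otimes> (y [^] \<alpha> \<otimes> c \<otimes> x [^] (- ?s) \<otimes> inv (c [^] n))"
      by (simp add: m_assoc)
    also have "\<dots> = (inv (y [^] \<alpha>) \<otimes> x) \<otimes> y [^] \<alpha> \<otimes> c"
      by (simp only: eq[symmetric]) (simp add: m_assoc)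
    also have "\<dots> = x \<otimes> inv (c [^] n) \<otimes> (y [^] ?s \<otimes> y [^] \<alpha>) \<otimes> c"
      by (simp only: yx) (simp add: m_assoc)
    also have "y [^] ?s \<otimes> y [^] \<alpha> = y [^] u"
      using False by (simp add: u_def flip: n_def int_pow_mult)
    finally have "c [^] n \<otimes> (inv x \<otimes> (c \<otimes> x [^] (- ?s) \<otimes> inv (c [^] n))) \<otimes> c [^] n
        = c [^] n \<otimes> (inv x \<otimes> (x \<otimes> inv (c [^] n) \<otimes> y [^] u \<otimes> c)) \<otimes> c [^] n"
      by simp
    then have "c [^] n \<otimes> (inv x \<otimes> c) \<otimes> x [^] (- ?s) = y [^] u \<otimes> (c \<otimes> c [^] n)"
      by (simp add: m_assoc)
    moreover have "inv x \<otimes> c = c \<otimes> x [^] (- \<alpha>)"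
      using x_pow_c[of "-1"] by (simp add: int_pow_neg)
    moreover have "x [^] (- \<alpha>) \<otimes> x [^] (- ?s) = x [^] (- u)"
      using False by (simp add: u_def algebra_simps flip: n_def int_pow_mult)
    moreover have "c \<otimes> c [^] n = c [^] Suc n"
      using nat_pow_Suc2[of c n] by simp
    ultimately show ?thesis
      by (simp add: n_def m_assoc)
  qed
qed

text \<open>Conjugating \<open>y\<^sup>u\<close> by the power of \<open>c\<close> in two ways yields a common power of \<open>x\<close> and \<open>y\<close>.\<close>

lemma y_pow_u: "y [^] u = x [^] (- u * \<alpha> ^ Suc absn)"
proof -
  define g where "g = c [^] Suc absn"
  have g: "g \<in> carrier G" by (simp add: g_def)
  let ?m = "\<alpha> ^ Suc absn"
  have yg: "y [^] u \<otimes> g = g \<otimes> x [^] (- u)"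
    using y_pow_u_conj by (simp only: g_def)
  have "inv g \<otimes> y [^] u \<otimes> g = inv g \<otimes> (y [^] u \<otimes> g)"
    using g by (simp add: m_assoc)
  then have "inv g \<otimes> y [^] u \<otimes> g = x [^] (- u)"
    using g by (simp add: yg)
  then have "(inv g \<otimes> y [^] u \<otimes> g) [^] ?m = x [^] (- u * ?m)"
    by (simp only: int_pow_pow[OF x])
  then have "inv g \<otimes> y [^] (u * ?m) \<otimes> g = x [^] (- u * ?m)"
    using conj_int_pow[of g "y [^] u" ?m] g by (simp add: int_pow_pow)
  moreover have "inv g \<otimes> y [^] (u * ?m) \<otimes> g = y [^] u"
  proof -
    have gy: "g \<otimes> y [^] u = y [^] (u * ?m) \<otimes> g"
      unfolding g_def by (rule c_pow_y_pow)
    have "inv g \<otimes> y [^] (u * ?m) \<otimes> g = inv g \<otimes> (y [^] (u * ?m) \<otimes> g)"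
      using g by (simp add: m_assoc)
    also have "\<dots> = y [^] u"
      using g by (simp only: gy[symmetric]) simp
    finally show ?thesis .
  qed
  ultimately show ?thesis
    by simp
qed

lemma x_commutes_y_pow_u: "x \<otimes> y [^] u = y [^] u \<otimes> x"
  unfolding y_pow_u by (rule commute_int_pow) simp_all

text \<open>\<open>y^u\<close> commutes with \<open>x\<close>, being a power of it, and with
  \<open>y\<close>, hence with \<open>c\<close>. Since moving \<open>c\<close> past it also turns it
  into \<open>y^(\<alpha> u)\<close>, the two powers agree.\<close>

lemma y_pow_u_power: "y [^] (u * (\<alpha> - 1)) = \<one>"
proof -
  have 1: "inv x \<otimes> y [^] u = y [^] u \<otimes> inv x"
    by (metis commute_int_pow[of "y [^] u" x "-1"] x_commutes_y_pow_u x y int_pow_closed int_pow_neg int_pow_1)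
  have 2: "y \<otimes> y [^] u = y [^] u \<otimes> y"
    by (rule commute_int_pow) simp_all
  have 3: "inv y \<otimes> y [^] u = y [^] u \<otimes> inv y"
    by (rule commute_int_pow) simp_all
  have "c \<otimes> y [^] u = inv x \<otimes> (inv y \<otimes> (x \<otimes> (y \<otimes> y [^] u)))"
    by (simp add: commut_def m_assoc)
  also have "\<dots> = y [^] u \<otimes> c"
    by (simp add: 1 2 3 x_commutes_y_pow_u commut_def flip: m_assoc)
  finally have "y [^] (\<alpha> * u) \<otimes> c = y [^] u \<otimes> c"
    by (simp add: c_y_pow)
  then have "y [^] (\<alpha> * u) = y [^] u"
    by simp
  then show ?thesis
    by (simp add: right_diff_distrib int_pow_diff mult.commute)
qed

end

section \<open>Congruences modulo 4\<close>

text \<open>As \<alpha> is -1 modulo 4, the summands of \<open>geo\<close> alternate between -1 and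
  1.\<close>

lemma geo_mod_4:
  assumes "\<alpha> mod 4 = 3"
  shows "geo \<alpha> n mod 4 = (if even n then 0 else 3)"
proof (induction n)
  case (Suc n)
  have "geo \<alpha> (Suc n) mod 4 = ((\<alpha> mod 4) * ((geo \<alpha> n mod 4 + 1) mod 4)) mod 4"
    by (simp only: geo.simps mod_mult_eq mod_add_left_eq)
  then show ?case
    by (simp add: assms Suc)
qed simp

lemma (in group) int_pow_mod:
  assumes "x \<in> carrier G" "x [^] (n::int) = \<one>"
  shows "x [^] (i mod n) = x [^] i"
proof -
  have "x [^] i = x [^] (n * (i div n) + i mod n)"
    by simp
  also have "\<dots> = (x [^] n) [^] (i div n) \<otimes> x [^] (i mod n)"
    using assms(1) by (simp only: int_pow_mult int_pow_pow)
  finally show ?thesis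
    using assms by simp
qed

context macdonald_pair
begin

text \<open>\<open>absn\<close> is odd, so modulo 4 the power with exponent \<open>Suc absn\<close>
  is 1 and \<open>geo\<close> is 3. The two branches of \<open>u\<close> give 1 - 3 and 3 + 3, both
  2.\<close>

lemma u_mod_4:
  assumes "\<alpha> mod 4 = 3"
  shows "u mod 4 = 2"
proof -
  have "odd \<alpha>"
    using assms by presburger
  then have "odd absn"
    by (simp add: absn_def even_nat_iff)
  then have geo: "geo \<alpha> absn mod 4 = 3"
    using geo_mod_4[OF assms] by simp
  have "\<alpha> ^ Suc absn mod 4 = (\<alpha> mod 4) ^ Suc absn mod 4"
    by (rule power_mod[symmetric])
  also have "\<dots> = (9 ^ (Suc absn div 2)) mod 4"
  proof -
    have "(3::int) ^ (2 * (Suc absn div 2)) = 9 ^ (Suc absn div 2)"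
      by (simp only: power_mult) simp
    then show ?thesis
      using \<open>odd absn\<close> by (simp add: assms)
  qed
  also have "\<dots> = (9 mod 4) ^ (Suc absn div 2) mod 4"
    by (rule power_mod[symmetric])
  finally have pow: "\<alpha> ^ Suc absn mod 4 = 1"
    by simp
  show ?thesis
  proof (cases "\<alpha> \<ge> 0")
    case True
    then have "u mod 4 = (\<alpha> ^ Suc absn mod 4 - geo \<alpha> absn mod 4) mod 4"
      by (simp only: u_def if_True mod_diff_eq)
    then show ?thesis
      by (simp only: pow geo) simp
  next
    case False
    then have "u mod 4 = (geo \<alpha> absn mod 4 + \<alpha> mod 4) mod 4"
      by (simp only: u_def if_False mod_add_eq)
    then show ?thesis
      by (simp only: assms geo) simp
  qed
qed

section \<open>Normal forms and finiteness\<close>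

text \<open>Moving \<open>c^j\<close> past a power of \<open>y\<close> multiplies the exponent by
  \<open>\<alpha> ^ j\<close>, hence the natural \<open>j\<close>.\<close>

definition normal_forms :: "'a set" where
  "normal_forms = {y [^] (i::int) \<otimes> c [^] (j::nat) \<otimes> x [^] (k::int) | i j k. True}"

text \<open>The absolute value \<open>N\<close> of \<open>u (\<alpha> - 1)\<close> kills
  \<open>x\<close> and \<open>y\<close>. Collecting \<open>x^N y\<close> then shows that
  \<open>c^N\<close> is a power of \<open>x\<close>, so \<open>N * N\<close> kills all
  three.\<close>

lemma torsion:
  assumes "\<alpha> mod 4 = 3"
  obtains N :: nat where "N > 0" "x [^] int N = \<one>" "y [^] int N = \<one>" "c [^] N = \<one>"
proof -
  interpret sw: macdonald_pair G y x \<alpha> by (rule swap)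
  define n where "n = u * (\<alpha> - 1)"
  have "u \<noteq> 0"
    using u_mod_4[OF assms] by auto
  then have "n \<noteq> 0"
    using assms by (auto simp: n_def)
  have pow: "z [^] int (nat \<bar>n\<bar>) = \<one>" if "z \<in> carrier G" "z [^] n = \<one>" for z
    using that by (cases "n \<ge> 0") (simp_all add: int_pow_neg)
  define N where "N = nat \<bar>n\<bar>"
  have N: "x [^] int N = \<one>" "y [^] int N = \<one>"
    using pow y_pow_u_power sw.y_pow_u_power by (simp_all add: N_def n_def)
  have "x [^] N \<otimes> y = y \<otimes> c [^] N \<otimes> x [^] geo \<alpha> N"
    by (rule x_pow_y)
  then have "inv y \<otimes> y = inv y \<otimes> (y \<otimes> (c [^] N \<otimes> x [^] geo \<alpha> N))"
    using N by (simp add: int_pow_int m_assoc)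
  then have "c [^] N \<otimes> x [^] geo \<alpha> N = \<one>"
    by simp
  then have "c [^] N = inv (x [^] geo \<alpha> N)"
    by (simp add: inv_equality)
  then have "c [^] N = x [^] (- geo \<alpha> N)"
    by (simp add: int_pow_neg)
  then have "c [^] (N * N) = (x [^] (- geo \<alpha> N)) [^] int N"
    by (simp add: int_pow_int flip: nat_pow_pow)
  also have "\<dots> = (x [^] int N) [^] (- geo \<alpha> N)"
    by (simp add: int_pow_pow mult.commute)
  finally have "c [^] (N * N) = \<one>"
    using N by simp
  moreover have "z [^] int (N * N) = \<one>" if "z \<in> carrier G" "z [^] int N = \<one>" for z
    using that by (simp flip: int_pow_pow)
  moreover have "N * N > 0"
    using \<open>n \<noteq> 0\<close> by (simp add: N_def)
  ultimately show ?thesis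
    using that[of "N * N"] N by blast
qed

lemma finite_normal_forms:
  assumes "\<alpha> mod 4 = 3"
  shows "finite normal_forms"
proof -
  obtain N :: nat where N: "N > 0" "x [^] int N = \<one>" "y [^] int N = \<one>" "c [^] N = \<one>"
    using torsion[OF assms] .
  have "normal_forms \<subseteq> (\<lambda>(i, j, k). y [^] (i::int) \<otimes> c [^] (j::int) \<otimes> x [^] (k::int)) `
      ({0..<int N} \<times> {0..<int N} \<times> {0..<int N})"
  proof
    fix z assume "z \<in> normal_forms"
    then obtain i k :: int and j :: nat where z: "z = y [^] i \<otimes> c [^] j \<otimes> x [^] k"
      by (auto simp: normal_forms_def)
    have "c [^] int N = \<one>"
      using N by (simp add: int_pow_int)
    then have "z = y [^] (i mod int N) \<otimes> c [^] (int j mod int N) \<otimes> x [^] (k mod int N)"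
      using N by (simp add: z int_pow_mod flip: int_pow_int)
    then show "z \<in> (\<lambda>(i, j, k). y [^] (i::int) \<otimes> c [^] (j::int) \<otimes> x [^] (k::int)) `
      ({0..<int N} \<times> {0..<int N} \<times> {0..<int N})"
      using N by (intro image_eqI[where x = "(i mod int N, int j mod int N, k mod int N)"]) auto
  qed
  then show ?thesis
    by (rule finite_subset) blast
qed

lemma one_normal_forms: "\<one> \<in> normal_forms"
  unfolding normal_forms_def by (auto intro!: exI[of _ 0] exI[of _ "0::nat"])

lemma normal_forms_x_pow:
  assumes "s \<in> normal_forms"
  shows "s \<otimes> x [^] (n::int) \<in> normal_forms"
proof -
  obtain i k :: int and j :: nat where s: "s = y [^] i \<otimes> c [^] j \<otimes> x [^] k"
    using assms by (auto simp: normal_forms_def)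
  have "s \<otimes> x [^] n = y [^] i \<otimes> c [^] j \<otimes> x [^] (k + n)"
    by (simp add: s m_assoc int_pow_mult)
  then show ?thesis
    by (auto simp: normal_forms_def)
qed

text \<open>Torsion makes the exponent of \<open>x\<close> a natural number, so that
  \<open>x^k y\<close> can be collected; the \<open>y\<close> so released is then moved to the left
  of \<open>c^j\<close>.\<close>

lemma normal_forms_y:
  assumes "\<alpha> mod 4 = 3" "s \<in> normal_forms"
  shows "s \<otimes> y \<in> normal_forms"
proof -
  obtain N :: nat where N: "N > 0" "x [^] int N = \<one>"
    using torsion[OF assms(1)] by blast
  obtain i k' :: int and j :: nat where s: "s = y [^] i \<otimes> c [^] j \<otimes> x [^] k'"
    using assms(2) by (auto simp: normal_forms_def)
  define k where "k = nat (k' mod int N)"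
  have "x [^] k' = x [^] (k' mod int N)"
    using N by (simp add: int_pow_mod)
  also have "\<dots> = x [^] k"
    using N by (simp add: k_def flip: int_pow_int)
  finally have "s \<otimes> y = y [^] i \<otimes> c [^] j \<otimes> (x [^] k \<otimes> y)"
    by (simp add: s m_assoc)
  also have "\<dots> = y [^] i \<otimes> (c [^] j \<otimes> y [^] (1::int)) \<otimes> (c [^] k \<otimes> x [^] geo \<alpha> k)"
    by (simp add: x_pow_y m_assoc)
  also have "\<dots> = y [^] (i + \<alpha> ^ j) \<otimes> c [^] (j + k) \<otimes> x [^] geo \<alpha> k"
    by (simp only: c_pow_y_pow) (simp add: m_assoc int_pow_mult flip: nat_pow_mult)
  finally show ?thesis
    by (auto simp: normal_forms_def)
qed

text \<open>By torsion, \<open>inv y\<close> is a natural power of \<open>y\<close>.\<close>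

lemma normal_forms_inv_y:
  assumes "\<alpha> mod 4 = 3" "s \<in> normal_forms"
  shows "s \<otimes> inv y \<in> normal_forms"
proof -
  obtain N :: nat where N: "N > 0" "y [^] int N = \<one>"
    using torsion[OF assms(1)] by blast
  have sc: "s \<in> carrier G"
    using assms(2) by (auto simp: normal_forms_def)
  have pow: "s \<otimes> y [^] (n::nat) \<in> normal_forms" for n
  proof (induction n)
    case (Suc n)
    then show ?case
      using normal_forms_y[OF assms(1) Suc] sc by (simp add: m_assoc)
  qed (use assms sc in simp)
  have "y [^] (N - 1) \<otimes> y = \<one>"
    using N nat_pow_Suc[of y "N - 1"] by (simp add: int_pow_int del: nat_pow_Suc)
  then have "inv y = y [^] (N - 1)"
    by (simp add: inv_equality)
  then show ?thesis
    using pow by simp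
qed

end


section \<open>The quaternion relations\<close>

text \<open>These relations bound the number of elements \<open>a^i b^s\<close> by 16; that there
  are exactly 16 is added in \<open>quaternion16_group\<close>.\<close>

locale quaternion16 = group G for G (structure) +
  fixes a b :: 'a
  assumes a [simp, intro]: "a \<in> carrier G" and b [simp, intro]: "b \<in> carrier G"
    and a_pow_8: "a [^] (8::int) = \<one>"
    and b_square: "b \<otimes> b = a [^] (4::int)"
    and conj_a: "inv b \<otimes> a \<otimes> b = inv a"
begin

text \<open>The flag tells whether the factor \<open>b\<close> is present. Exponents range over all
  integers and matter only modulo 8, which keeps the product formula free of reductions.\<close>

definition el :: "int \<Rightarrow> bool \<Rightarrow> 'a" where
  "el i s = a [^] i \<otimes> (if s then b else \<one>)"

lemma el_closed [simp, intro]: "el i s \<in> carrier G"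
  by (simp add: el_def)

lemma el_cong: "i mod 8 = j mod 8 \<Longrightarrow> el i s = el j s"
  unfolding el_def by (metis a a_pow_8 int_pow_mod)

lemma b_a_pow: "b \<otimes> a [^] i = a [^] (- i) \<otimes> b" for i :: int
proof -
  have "inv b \<otimes> a [^] (- i) \<otimes> b = a [^] i"
    using conj_int_pow[of b a "- i"] by (simp add: conj_a int_pow_neg int_pow_inv)
  then have "b \<otimes> (inv b \<otimes> a [^] (- i) \<otimes> b) = b \<otimes> a [^] i"
    by simp
  then show ?thesis
    by (simp add: m_assoc)
qed

text \<open>\<open>b\<close> inverts each power of \<open>a\<close> that it passes, and two factors
  \<open>b\<close> merge into \<open>a^4\<close>.\<close>

lemma el_mult:
  "el i s \<otimes> el j t = el (i + (if s then - j else j) + (if s \<and> t then 4 else 0)) (s \<noteq> t)"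
proof -
  have "b \<otimes> (a [^] j \<otimes> z) = a [^] (- j) \<otimes> (b \<otimes> z)" if "z \<in> carrier G" for z
    using that by (simp add: b_a_pow flip: m_assoc)
  moreover have "a [^] i \<otimes> (a [^] j \<otimes> z) = a [^] (i + j) \<otimes> z" if "z \<in> carrier G" for z and i j :: int
    using that by (simp add: m_assoc int_pow_mult)
  ultimately show ?thesis
    by (cases s; cases t) (simp_all add: el_def m_assoc b_a_pow b_square algebra_simps flip: int_pow_mult)
qed

lemma one_eq_el: "\<one> = el 0 False"
  by (simp add: el_def)

lemma a_eq_el: "a = el 1 False"
  by (simp add: el_def)

lemma b_eq_el: "b = el 0 True"
  by (simp add: el_def)

text \<open>The shift by 4 comes from \<open>inv b = a^4 b\<close>.\<close>

lemma inv_el: "inv (el i s) = el (if s then i + 4 else - i) s"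
  by (rule inv_equality) (auto simp: el_mult one_eq_el intro: el_cong)

definition els :: "'a set" where
  "els = {el i s | i s. True}"

lemma el_in_els [simp, intro]: "el i s \<in> els"
  by (auto simp: els_def)

lemma els_eq_image: "els = (\<lambda>(i, s). el i s) ` ({0..<8} \<times> UNIV)"
proof
  show "els \<subseteq> (\<lambda>(i, s). el i s) ` ({0..<8} \<times> UNIV)"
  proof
    fix z assume "z \<in> els"
    then obtain i s where "z = el i s"
      by (auto simp: els_def)
    then have "z = (\<lambda>(i, s). el i s) (i mod 8, s)"
      by (auto intro: el_cong)
    then show "z \<in> (\<lambda>(i, s). el i s) ` ({0..<8} \<times> UNIV)"
      by (rule image_eqI) simp
  qed
qed auto

lemma finite_els: "finite els"
  by (simp add: els_eq_image)

lemma card_els_le: "card els \<le> 16"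
proof -
  have "card els \<le> card ({0..<8::int} \<times> (UNIV :: bool set))"
    unfolding els_eq_image by (rule card_image_le) simp
  then show ?thesis
    by (simp add: card_cartesian_product)
qed

lemma els_subset_subgroup:
  assumes "subgroup S G" "a \<in> S" "b \<in> S"
  shows "els \<subseteq> S"
  using assms by (auto simp: els_def el_def subgroup_int_pow_closed subgroup.m_closed)

lemma els_closed:
  assumes "z \<in> els" "w \<in> els"
  shows "z \<otimes> w \<in> els" "z \<otimes> inv w \<in> els"
  using assms by (auto simp: els_def el_mult inv_el) blast+

text \<open>The central series below reduce to divisibility of this exponent.\<close>

lemma commut_el:
  "commut G (el i s) (el j t) = el (2 * ((if s then j else 0) - (if t then i else 0)) * (if s \<and> t then -1 else 1)) False"
  by (cases s; cases t) (auto simp: commut_def el_mult inv_el intro: el_cong)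

end

text \<open>In a finite 2-group, \<open>u \<equiv> 2 (mod 4)\<close> and \<open>u (\<alpha> - 1) \<equiv> 4 (mod 8)\<close> collapse the relations.\<close>

lemma (in macdonald_pair) quaternion16_if_2_group:
  assumes \<alpha>: "\<alpha> mod 4 = 3" and fin: "finite (carrier G)" and ord: "order G = 2 ^ m"
  shows "quaternion16 G (y \<otimes> inv x) x"
proof -
  interpret sw: macdonald_pair G y x \<alpha> by (rule swap)
  note u4 = u_mod_4[OF \<alpha>]
  define v where "v = u div 2 * ((\<alpha> - 1) div 2)"
  have "odd (u div 2)" "odd ((\<alpha> - 1) div 2)"
    using u4 \<alpha> by presburger+
  then have "odd v"
    by (simp add: v_def)
  have "2 * (u div 2) = u" "2 * ((\<alpha> - 1) div 2) = \<alpha> - 1"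
    using u4 \<alpha> by presburger+
  then have "u * (\<alpha> - 1) = (2 * (u div 2)) * (2 * ((\<alpha> - 1) div 2))"
    by (simp only:)
  also have "\<dots> = 4 * v"
  proof -
    have "(2 * p) * (2 * q) = 4 * (p * q)" for p q :: int
      by simp
    then show ?thesis
      unfolding v_def .
  qed
  finally have uv: "u * (\<alpha> - 1) = 4 * v" .
  \<comment> \<open>The order of \<open>z\<close> is a power of 2, hence coprime to the odd
    \<open>v\<close>, so it divides 4 as soon as it divides \<open>4 * v\<close>.\<close>
  have pow4: "z [^] (4::int) = \<one>" if "z \<in> carrier G" "z [^] (u * (\<alpha> - 1)) = \<one>" for z
  proof -
    have "ord z dvd 2 ^ m"
      using ord_dvd_group_order[OF that(1)] ord by simp
    then obtain j where j: "ord z = 2 ^ j"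
      using divides_primepow_nat two_is_prime_nat by blast
    have "int (ord z) dvd 4 * v"
      using that uv by (simp add: int_pow_eq_id)
    moreover have "coprime (int (ord z)) v"
      using \<open>odd v\<close> by (simp add: j)
    ultimately have "int (ord z) dvd 4"
      by (simp add: coprime_dvd_mult_left_iff)
    then show ?thesis
      using that by (simp add: int_pow_eq_id)
  qed
  have x4: "x [^] (4::int) = \<one>" and y4: "y [^] (4::int) = \<one>"
    using pow4 y_pow_u_power sw.y_pow_u_power by simp_all
  have xmod: "x [^] (i::int) = x [^] j" if "i mod 4 = j mod 4" for i j
    using int_pow_mod[OF x x4] that by metis
  \<comment> \<open>Modulo 4, both \<open>u\<close> and \<open>- u * \<alpha> ^ Suc absn\<close> are
    2, so \<open>y_pow_u\<close> collapses to an equality of squares.\<close>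
  have "y [^] (2::int) = y [^] u"
    using int_pow_mod[OF y y4, of u] by (simp add: u4)
  also have "\<dots> = x [^] (- u * \<alpha> ^ Suc absn)"
    by (rule y_pow_u)
  also have "\<dots> = x [^] (2::int)"
  proof (rule xmod)
    have "odd (- (u div 2) * \<alpha> ^ Suc absn)"
      using \<open>odd (u div 2)\<close> \<alpha> by (simp; presburger)
    moreover have "- u * \<alpha> ^ Suc absn = 2 * (- (u div 2) * \<alpha> ^ Suc absn)"
      using \<open>2 * (u div 2) = u\<close> by (metis mult.assoc mult_minus_right)
    moreover have "2 * q mod 4 = 2 mod 4" if "odd q" for q :: int
      using that mod_mult_mult1[of 2 q 2] by (simp add: odd_iff_mod_2_eq_one)
    ultimately show "- u * \<alpha> ^ Suc absn mod 4 = 2 mod 4"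
      by (simp only:)
  qed
  finally have yx2: "y [^] (2::int) = x [^] (2::int)" .
  have sq: "z [^] (2::int) = z \<otimes> z" if "z \<in> carrier G" for z
    using that int_pow_mult[of z 1 1] by simp
  have yy: "y \<otimes> y = x \<otimes> x"
    using yx2 by (simp add: sq)
  \<comment> \<open>In the collection formula for exponent 2 the power of \<open>x\<close>
    disappears, since \<open>geo \<alpha> 2\<close> is divisible by 4, and \<open>x x = y y\<close>
    commutes with \<open>y\<close>.\<close>
  have "x [^] (2::nat) \<otimes> y = y \<otimes> c [^] (2::nat) \<otimes> x [^] geo \<alpha> 2"
    by (rule x_pow_y)
  also have "x [^] geo \<alpha> 2 = x [^] (0::int)"
    by (rule xmod) (simp add: geo_mod_4[OF \<alpha>])
  also have "x [^] (2::nat) \<otimes> y = y \<otimes> (x \<otimes> x)"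
    by (simp add: numeral_2_eq_2 m_assoc flip: yy)
  finally have cc: "c \<otimes> c = x \<otimes> x"
    by (simp add: numeral_2_eq_2 m_assoc)
  have xxxx: "x \<otimes> x \<otimes> (x \<otimes> x) = \<one>"
    using x4 int_pow_mult[of x 2 2] by (simp add: sq)
  have inv_xx: "inv (x \<otimes> x) = x \<otimes> x"
    using xxxx by (simp add: inv_equality)
  define a where "a = y \<otimes> inv x"
  have conj: "inv x \<otimes> a \<otimes> x = inv a"
  proof -
    have "inv x \<otimes> y = x \<otimes> inv y"
      by (metis inv_xx yy x y inv_mult_cancel(1) inv_mult_group inv_closed m_closed m_assoc inv_solve_right)
    then show ?thesis
      by (simp add: a_def m_assoc inv_mult_group)
  qed
  \<comment> \<open>Since \<open>x x = y y\<close>, the square of \<open>a\<close> is a conjugate of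
    \<open>inv c\<close>. Hence \<open>a^4\<close> is the conjugate of
    \<open>inv (c c) = x x\<close> under the same element, which is again
    \<open>x x\<close>.\<close>
  have a2: "a \<otimes> a = (y \<otimes> x) \<otimes> inv c \<otimes> inv (y \<otimes> x)"
  proof -
    have "inv x \<otimes> y = x \<otimes> inv y"
      using conj by (simp add: a_def m_assoc inv_mult_group)
    then have "a \<otimes> a = y \<otimes> (x \<otimes> inv y) \<otimes> inv x"
      by (simp add: a_def m_assoc flip: m_assoc[of "inv x" y])
    then show ?thesis
      by (simp add: commut_def m_assoc inv_mult_group)
  qed
  have "a \<otimes> a \<otimes> (a \<otimes> a) = (y \<otimes> x) \<otimes> inv (c \<otimes> c) \<otimes> inv (y \<otimes> x)"
    unfolding a2 by (simp add: m_assoc inv_mult_group)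
  also have "\<dots> = y \<otimes> (x \<otimes> (x \<otimes> x)) \<otimes> inv (y \<otimes> x)"
    by (simp only: cc inv_xx) (simp add: m_assoc)
  also have "\<dots> = (y \<otimes> (y \<otimes> y)) \<otimes> inv y"
    by (simp add: m_assoc inv_mult_group yy)
  also have "\<dots> = y \<otimes> y"
    by (simp add: m_assoc)
  finally have a4: "a \<otimes> a \<otimes> (a \<otimes> a) = x \<otimes> x"
    by (simp only: yy)
  have ac: "a \<in> carrier G"
    by (simp add: a_def)
  have a4': "a [^] (4::int) = x \<otimes> x"
    using a4 int_pow_mult[of a 2 2] ac by (simp add: sq)
  have "a [^] (8::int) = \<one>"
    using int_pow_mult[of a 4 4] ac by (simp add: a4' xxxx)
  then show ?thesis
    using conj a4' by unfold_locales (simp_all flip: a_def add: ac)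
qed

section \<open>Central series\<close>

text \<open>Right cosets are compared by \<open>x inv y\<close>; normality allows the other order,
  which fits the form of the commutator in \<open>commut_eq_inv_mult\<close>.\<close>

lemma (in normal) r_coset_eq_iff:
  assumes "x \<in> carrier G" "y \<in> carrier G"
  shows "H #> x = H #> y \<longleftrightarrow> inv y \<otimes> x \<in> H"
proof -
  have "H #> x = H #> y \<longleftrightarrow> x \<in> H #> y"
    using assms by (metis repr_independence rcos_self is_subgroup)
  also have "\<dots> \<longleftrightarrow> x \<otimes> inv y \<in> H"
    using assms by (simp add: rcos_module is_group)
  also have "\<dots> \<longleftrightarrow> inv y \<otimes> x \<in> H"
  proof
    assume "x \<otimes> inv y \<in> H"
    from inv_op_closed1[OF assms(2) this] show "inv y \<otimes> x \<in> H"
      using assms by (simp add: m_assoc)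
  next
    assume "inv y \<otimes> x \<in> H"
    from inv_op_closed2[OF assms(2) this] show "x \<otimes> inv y \<in> H"
      using assms by (simp add: m_assoc)
  qed
  finally show ?thesis .
qed

lemma (in group) commut_eq_inv_mult:
  assumes "x \<in> carrier G" "y \<in> carrier G"
  shows "commut G x y = inv (y \<otimes> x) \<otimes> (x \<otimes> y)"
  using assms by (simp add: commut_def inv_mult_group m_assoc)

lemma (in normal) r_coset_in_center_iff:
  assumes "x \<in> carrier G"
  shows "H #> x \<in> center (G Mod H) \<longleftrightarrow> (\<forall>y \<in> carrier G. commut G x y \<in> H)"
  using assms
  by (auto simp: center_def carrier_FactGroup rcos_sum r_coset_eq_iff commut_eq_inv_mult)

text \<open>This allows the upper central series to be computed inside \<open>G\<close>, without
  factor groups.\<close>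

lemma (in group) upper_central_Suc:
  assumes "upper_central G i \<lhd> G"
  shows "upper_central G (Suc i) = {x \<in> carrier G. \<forall>y \<in> carrier G. commut G x y \<in> upper_central G i}"
  using normal.r_coset_in_center_iff[OF assms] by auto

lemma (in group) commut_eq_one_iff:
  assumes "x \<in> carrier G" "y \<in> carrier G"
  shows "commut G x y = \<one> \<longleftrightarrow> x \<otimes> y = y \<otimes> x"
proof -
  have "inv (y \<otimes> x) \<otimes> (x \<otimes> y) = \<one> \<longleftrightarrow> x \<otimes> y = y \<otimes> x"
    using assms by (metis inv_solve_left m_closed one_closed r_one)
  then show ?thesis
    using assms by (simp add: commut_eq_inv_mult)
qed

text \<open>The singleton gives the condition the shape of \<open>commut_in_rot\<close>, where the
  trivial subgroup is \<open>rot 8\<close>.\<close>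

lemma (in group) center_eq: "center G = {x \<in> carrier G. \<forall>y \<in> carrier G. commut G x y \<in> {\<one>}}"
  by (auto simp: center_def commut_eq_one_iff)

section \<open>Structure of the quaternion group of order 16\<close>

locale quaternion16_group = quaternion16 +
  assumes carrier_eq: "carrier G = els" and card_carrier: "card (carrier G) = 16"
begin

text \<open>The 16 pairs with exponent from 0 to 7 are mapped onto 16 elements, so the map is
  injective on them.\<close>

lemma el_eq_iff: "el i s = el j t \<longleftrightarrow> i mod 8 = j mod 8 \<and> s = t"
proof
  have inj: "inj_on (\<lambda>(i, s). el i s) ({0..<8} \<times> UNIV)"
    by (rule eq_card_imp_inj_on)
      (simp_all flip: els_eq_image add: carrier_eq[symmetric] card_carrier card_cartesian_product)
  assume "el i s = el j t"
  then have "(\<lambda>(i, s). el i s) (i mod 8, s) = (\<lambda>(i, s). el i s) (j mod 8, t)"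
    using el_cong[of "i mod 8" i s] el_cong[of "j mod 8" j t] by simp
  from inj_onD[OF inj this] show "i mod 8 = j mod 8 \<and> s = t"
    by simp
qed (auto intro: el_cong)

lemma carrier_cases:
  assumes "x \<in> carrier G"
  obtains i s where "x = el i s"
  using assms by (auto simp: carrier_eq els_def)

definition rot :: "int \<Rightarrow> 'a set" where
  "rot k = {el (k * m) False | m. True}"

text \<open>Exponents are determined modulo 8 only, and a divisor of 8 divides either all or none of
  the representatives.\<close>

lemma el_in_rot_iff:
  assumes "k dvd 8"
  shows "el i s \<in> rot k \<longleftrightarrow> \<not> s \<and> k dvd i"
proof
  assume "el i s \<in> rot k"
  then obtain m where "i mod 8 = (k * m) mod 8" "\<not> s"
    by (auto simp: rot_def el_eq_iff)
  moreover from this(1) have "8 dvd i - k * m"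
    by (simp add: mod_eq_dvd_iff)
  then have "k dvd i - k * m"
    using assms by (rule dvd_trans[rotated])
  ultimately show "\<not> s \<and> k dvd i"
    by (metis dvd_add_triv_right_iff diff_add_cancel dvd_triv_left dvd_add)
qed (auto simp: rot_def dvd_def)

lemma rot_eq_generate: "rot k = generate G {el k False}"
proof -
  have "el k False [^] (m::int) = el (k * m) False" for m
    by (simp add: el_def int_pow_pow)
  then show ?thesis
    by (auto simp: generate_pow rot_def)
qed

lemma rot_8: "rot 8 = {\<one>}"
  by (auto simp: rot_def one_eq_el el_eq_iff)

lemma subgroup_rot: "subgroup (rot k) G"
  unfolding rot_eq_generate by (rule generate_is_subgroup) simp

lemma normal_rot:
  assumes "k dvd 8"
  shows "rot k \<lhd> G"
proof -
  have "el i s \<otimes> h \<otimes> inv (el i s) \<in> rot k" if h_rot: "h \<in> rot k" for i s h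
  proof -
    obtain m where h: "h = el (k * m) False"
      using h_rot by (auto simp: rot_def)
    have "k dvd 8 - k * m"
      by (rule dvd_diff) (simp_all add: assms)
    then show ?thesis
      using assms by (cases s) (simp_all add: h el_mult inv_el el_in_rot_iff)
  qed
  then show ?thesis
    by (auto simp: normal_inv_iff subgroup_rot elim!: carrier_cases)
qed

text \<open>By \<open>commut_el\<close>, \<open>k\<close> has to divide half of the exponent.
  Testing \<open>a^i\<close> against \<open>b\<close> gives \<open>k dvd i\<close>; testing
  \<open>a^i b\<close> against \<open>a\<close> gives \<open>k dvd 1\<close>, so these elements
  enter only when \<open>k\<close> is a unit.\<close>

lemma commut_in_rot:
  assumes "k dvd 4"
  shows "{x \<in> carrier G. \<forall>y \<in> carrier G. commut G x y \<in> rot (2 * k)}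
    = (if k dvd 1 then carrier G else rot k)"
proof -
  have k8: "k dvd 8" "2 * k dvd 8"
    using assms(1) dvd_trans[of k 4 8] mult_dvd_mono[of 2 2 k 4] by simp_all
  have *: "(\<forall>y \<in> carrier G. commut G (el i s) y \<in> rot (2 * k)) \<longleftrightarrow> (if s then k dvd 1 else k dvd i)" for i s
  proof -
    have "(\<forall>y \<in> carrier G. commut G (el i s) y \<in> rot (2 * k)) \<longleftrightarrow>
        (\<forall>j t. commut G (el i s) (el j t) \<in> rot (2 * k))"
      by (auto elim!: carrier_cases)
    also have "\<dots> \<longleftrightarrow>
        (\<forall>j t. k dvd ((if s then j else 0) - (if t then i else 0)) * (if s \<and> t then -1 else 1))"
      by (simp only: commut_el el_in_rot_iff[OF k8(2)] mult.assoc dvd_mult_cancel_left) simp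
    also have "\<dots> \<longleftrightarrow> (if s then k dvd 1 else k dvd i)"
    proof (cases s)
      case True
      show ?thesis
      proof
        assume *: "\<forall>j t. k dvd ((if s then j else 0) - (if t then i else 0)) * (if s \<and> t then -1 else 1)"
        show "if s then k dvd 1 else k dvd i"
          \<comment> \<open>The instance \<open>j = 1\<close>, \<open>t = False\<close> is the
            commutator with \<open>a\<close>.\<close>
          using spec[OF spec[OF *, of 1], of False] True by simp
      next
        assume *: "if s then k dvd 1 else k dvd i"
        have "k dvd n" for n
          by (rule dvd_trans[of k 1]) (use * True in simp_all)
        then show "\<forall>j t. k dvd ((if s then j else 0) - (if t then i else 0)) * (if s \<and> t then -1 else 1)"
          by blast
      qed
    qed auto
    finally show ?thesis .
  qed
  have **: "k dvd i" if "k dvd 1" for i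
    using that by (rule dvd_trans) simp
  have "x \<in> carrier G \<and> (\<forall>y \<in> carrier G. commut G x y \<in> rot (2 * k)) \<longleftrightarrow>
      x \<in> (if k dvd 1 then carrier G else rot k)" for x
  proof (cases "x \<in> carrier G")
    case True
    then obtain i s where x: "x = el i s"
      by (rule carrier_cases)
    show ?thesis
      unfolding x * using ** by (simp add: el_in_rot_iff[OF k8(1)])
  next
    case False
    then show ?thesis
      using subgroup.subset[OF subgroup_rot] by auto
  qed
  then show ?thesis
    by blast
qed

lemma center: "center G = rot 4"
  unfolding center_eq rot_8[symmetric] using commut_in_rot[of 4] by simp

text \<open>The series runs through \<open>rot 8\<close>, \<open>rot 4\<close> and
  \<open>rot 2\<close>; at \<open>k = 1\<close> the elements outside the cyclic subgroup enter
  together with \<open>a\<close>.\<close>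

lemma upper_central_step:
  assumes "upper_central G i = rot (2 * k)" "k dvd 4"
  shows "upper_central G (Suc i) = (if k dvd 1 then carrier G else rot k)"
proof -
  have "2 * k dvd 8"
    using assms(2) mult_dvd_mono[of 2 2 k 4] by simp
  then show ?thesis
    using upper_central_Suc[of i] normal_rot assms commut_in_rot[OF assms(2)] by simp
qed

lemma upper_central_1: "upper_central G 1 = rot 4"
  using upper_central_step[of 0 4] by (simp add: rot_8)

lemma upper_central_2: "upper_central G 2 = rot 2"
  using upper_central_step[of 1 2] upper_central_1 by (simp add: numeral_2_eq_2)

lemma upper_central_3: "upper_central G 3 = carrier G"
  using upper_central_step[of 2 1] upper_central_2 by (simp add: eval_nat_numeral)

text \<open>The terms before the third are proper because they do not contain
  \<open>b\<close>.\<close>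

lemma nilpotent_of_class_3: "nilpotent_of_class G 3"
proof -
  have "rot k \<noteq> carrier G" if "k dvd 8" for k
    using el_in_rot_iff[OF that, of 0 True] el_closed by blast
  then have "rot 8 \<noteq> carrier G" "rot 4 \<noteq> carrier G" "rot 2 \<noteq> carrier G"
    by simp_all
  moreover have "i = 0 \<or> i = 1 \<or> i = 2" if "i < 3" for i :: nat
    using that by auto
  ultimately have "upper_central G i \<noteq> carrier G" if "i < 3" for i
    using that upper_central_1 upper_central_2 rot_8 upper_central.simps(1) by metis
  then show ?thesis
    by (simp add: nilpotent_of_class_def upper_central_3 del: upper_central.simps)
qed

text \<open>The single commutator \<open>[b, a^k] = a^(2k)\<close> already generates the right-hand
  side.\<close>

lemma commut_subgroup_rot:
  assumes "k dvd 4"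
  shows "commut_subgroup G (carrier G) (rot k) = rot (2 * k)"
proof
  have k8: "2 * k dvd 8"
    using assms mult_dvd_mono[of 2 2 k 4] by simp
  have "commut G x h \<in> rot (2 * k)" if "x \<in> carrier G" "h \<in> rot k" for x h
    using that k8 by (auto elim!: carrier_cases simp: rot_def[of k] commut_el el_in_rot_iff)
  then show "commut_subgroup G (carrier G) (rot k) \<subseteq> rot (2 * k)"
    unfolding commut_subgroup_def by (intro generate_subgroup_incl subgroup_rot) auto
  have "el (2 * k) False = commut G (el 0 True) (el k False)"
    by (simp add: commut_el)
  moreover have "el k False \<in> rot k"
    unfolding rot_eq_generate by (rule generate.incl) simp
  ultimately have "el (2 * k) False \<in> {commut G x h | x h. x \<in> carrier G \<and> h \<in> rot k}"
    by blast
  then show "rot (2 * k) \<subseteq> commut_subgroup G (carrier G) (rot k)"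
    unfolding rot_eq_generate[of "2 * k"] commut_subgroup_def by (intro mono_generate) simp
qed

text \<open>\<open>commut_in_rot\<close> with \<open>k = 1\<close> is the upper bound, and
  commutators with powers of \<open>a\<close> attain it.\<close>

lemma lower_central_2: "lower_central G 2 = rot 2"
proof
  have "commut G x h \<in> rot 2" if "x \<in> carrier G" "h \<in> carrier G" for x h
    using commut_in_rot[of 1] that by auto
  then have "commut_subgroup G (carrier G) (carrier G) \<subseteq> rot 2"
    unfolding commut_subgroup_def by (intro generate_subgroup_incl subgroup_rot) auto
  moreover have "commut_subgroup G (carrier G) (rot 1) \<subseteq> commut_subgroup G (carrier G) (carrier G)"
    unfolding commut_subgroup_def using subgroup.subset[OF subgroup_rot[of 1]]
    by (intro mono_generate) blast
  then have "rot 2 \<subseteq> commut_subgroup G (carrier G) (carrier G)"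
    using commut_subgroup_rot[of 1] by simp
  ultimately show "lower_central G 2 \<subseteq> rot 2" "rot 2 \<subseteq> lower_central G 2"
    by (simp_all add: numeral_2_eq_2)
qed

lemma lower_central_3: "lower_central G 3 = rot 4"
  using lower_central_2 commut_subgroup_rot[of 2] by (simp add: eval_nat_numeral)

text \<open>Elements outside the cyclic subgroup square to \<open>a^4\<close>, so three squarings
  kill every element, while \<open>a\<close> has order 8.\<close>

lemma has_exponent_8: "has_exponent G 8"
proof -
  have sq: "el i s [^] (2::nat) = el (if s then 4 else 2 * i) False" for i s
    by (cases s) (simp_all only: numeral_2_eq_2 el_mult nat_pow_Suc nat_pow_0 l_one el_closed, simp_all)
  have "el i s [^] (8::nat) = ((el i s [^] (2::nat)) [^] (2::nat)) [^] (2::nat)" for i s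
    by (simp add: nat_pow_pow)
  then have "el i s [^] (8::nat) = \<one>" for i s
    by (auto simp: sq one_eq_el el_eq_iff)
  moreover have "8 \<le> n" if "0 < n" "\<forall>x \<in> carrier G. x [^] n = \<one>" for n :: nat
  proof -
    have "el 1 False [^] n = el (int n) False"
      by (simp add: el_def int_pow_int)
    then have "el (int n) False = el 0 False"
      using that by (simp add: one_eq_el)
    then have "8 dvd int n"
      by (auto simp: el_eq_iff)
    then show ?thesis
      using that by (auto dest: zdvd_imp_le)
  qed
  ultimately show ?thesis
    by (auto simp: has_exponent_def elim!: carrier_cases)
qed

end

section \<open>Homomorphisms from presented groups\<close>

primrec word_eval :: "('a, 'b) monoid_scheme \<Rightarrow> ('g \<Rightarrow> 'a) \<Rightarrow> 'g word \<Rightarrow> 'a" where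
  "word_eval H f [] = \<one>\<^bsub>H\<^esub>"
| "word_eval H f (l # w) =
    (if snd l then f (fst l) else inv\<^bsub>H\<^esub> f (fst l)) \<otimes>\<^bsub>H\<^esub> word_eval H f w"

context
  fixes H :: "('a, 'b) monoid_scheme" (structure) and f :: "'g \<Rightarrow> 'a"
  assumes H: "group H" and f: "\<And>g. f g \<in> carrier H"
begin

interpretation group H by (rule H)

lemma word_eval_closed [simp]: "word_eval H f w \<in> carrier H"
  by (induction w) (simp_all add: f)

lemma word_eval_append: "word_eval H f (v @ w) = word_eval H f v \<otimes> word_eval H f w"
  by (induction v) (simp_all add: f m_assoc)

lemma word_eval_inv: "word_eval H f (word_inv w) = inv (word_eval H f w)"
  by (induction w) (auto simp: word_inv_def word_eval_append f inv_mult_group)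

lemma word_eval_pow: "word_eval H f (word_pow w k) = word_eval H f w [^] k"
proof -
  have pow: "word_eval H f (concat (replicate n w)) = word_eval H f w [^] n" for n w
    by (induction n) (simp_all add: word_eval_append nat_pow_Suc2[symmetric] del: nat_pow_Suc)
  show ?thesis
  proof (cases "0 \<le> k")
    case True
    then have "word_pow w k = concat (replicate (nat k) w)"
      by (simp add: word_pow_def)
    moreover have "word_eval H f w [^] k = word_eval H f w [^] nat k"
      using True int_pow_int[of H "word_eval H f w" "nat k"] by simp
    ultimately show ?thesis
      by (simp only: pow)
  next
    case False
    then have "word_pow w k = concat (replicate (nat (- k)) (word_inv w))"
      by (simp add: word_pow_def)
    then have "word_eval H f (word_pow w k) = inv (word_eval H f w) [^] nat (- k)"
      by (simp only: pow word_eval_inv)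
    also have "\<dots> = inv (word_eval H f w [^] nat (- k))"
      by (rule nat_pow_inv) simp
    also have "\<dots> = word_eval H f w [^] k"
      using False int_pow_neg_int[of "word_eval H f w" "nat (- k)"] by simp
    finally show ?thesis .
  qed
qed

lemma word_eval_conj:
  "word_eval H f (word_conj u v) = inv (word_eval H f v) \<otimes> word_eval H f u \<otimes> word_eval H f v"
  by (simp add: word_conj_def word_eval_append word_eval_inv m_assoc)

lemma word_eval_comm:
  "word_eval H f (word_comm u v) = commut H (word_eval H f u) (word_eval H f v)"
  by (simp add: word_comm_def commut_def word_eval_append word_eval_inv m_assoc)

lemma word_eval_cong:
  assumes R: "\<And>u v. (u, v) \<in> R \<Longrightarrow> word_eval H f u = word_eval H f v"
    and "(u, v) \<in> pres_cong R"
  shows "word_eval H f u = word_eval H f v"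
  using assms(2) by induction (auto simp: R word_eval_append f)

text \<open>\<open>word_eval\<close> is constant on congruence classes, so the value at a chosen
  representative is the value at every one.\<close>

lemma von_dyck:
  assumes R: "\<And>u v. (u, v) \<in> R \<Longrightarrow> word_eval H f u = word_eval H f v"
  obtains h where "h \<in> hom (presented_group R) H" "\<And>w. h (pres_class R w) = word_eval H f w"
proof
  define h where "h X = word_eval H f (SOME w. w \<in> X)" for X
  show h: "h (pres_class R w) = word_eval H f w" for w
  proof -
    have "w \<in> pres_class R w"
      by (simp add: pres_class_def pres_cong.refl)
    then have "(SOME w'. w' \<in> pres_class R w) \<in> pres_class R w"
      by (rule someI)
    then show ?thesis
      unfolding h_def using word_eval_cong[OF R] by (metis Image_singleton_iff pres_class_def)
  qed
  show "h \<in> hom (presented_group R) H"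
    by (auto simp: hom_def carrier_presented_group mult_presented_group h word_eval_append)
qed

end

text \<open>Words are built up from the left, so stability of \<open>S\<close> under right
  multiplication by generators and their inverses suffices. With the identity as \<open>h\<close> it
  confines the presented group itself to \<open>S\<close>.\<close>

lemma hom_presented_group_image_subset:
  assumes "group H" and h: "h \<in> hom (presented_group R) H" and one: "\<one>\<^bsub>H\<^esub> \<in> S"
    and gen: "\<And>s g. s \<in> S \<Longrightarrow> s \<otimes>\<^bsub>H\<^esub> h (pres_class R [(g, True)]) \<in> S"
    and inv_gen: "\<And>s g. s \<in> S \<Longrightarrow> s \<otimes>\<^bsub>H\<^esub> inv\<^bsub>H\<^esub> h (pres_class R [(g, True)]) \<in> S"
  shows "h ` carrier (presented_group R) \<subseteq> S"
proof -
  interpret P: group "presented_group R" by (rule group_presented_group)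
  interpret h: group_hom "presented_group R" H h
    using assms by (simp add: group_hom_def group_hom_axioms_def group_presented_group)
  have in_carrier [simp]: "pres_class R w \<in> carrier (presented_group R)" for w
    by (simp add: carrier_presented_group)
  have "h (pres_class R w) \<in> S" for w
  proof (induction w rule: rev_induct)
    case Nil
    show ?case
      using one h.hom_one by (simp add: one_presented_group)
  next
    case (snoc l w)
    obtain g s where l: "l = (g, s)" by fastforce
    have inv: "pres_class R [(g, False)] = inv\<^bsub>presented_group R\<^esub> (pres_class R [(g, True)])"
      by (simp add: inv_presented_group word_inv_def)
    have "h (pres_class R (w @ [l])) = h (pres_class R w) \<otimes>\<^bsub>H\<^esub> h (pres_class R [l])"
      by (simp flip: mult_presented_group)
    also have "h (pres_class R [l]) =
        (if s then h (pres_class R [(g, True)]) else inv\<^bsub>H\<^esub> h (pres_class R [(g, True)]))"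
      by (simp add: l inv)
    finally show ?case
      using gen[OF snoc] inv_gen[OF snoc] by simp
  qed
  then show ?thesis
    by (auto simp: carrier_presented_group)
qed

text \<open>First isomorphism theorem and Lagrange.\<close>

lemma order_dvd_if_epi:
  assumes "group G" "group H" "h \<in> hom G H" "h ` carrier G = carrier H"
  shows "order H dvd order G"
proof -
  interpret group_hom G H h
    using assms by (simp add: group_hom_def group_hom_axioms_def)
  have "card (carrier (G Mod kernel G H h)) = order H"
    using iso_same_card[OF FactGroup_iso[OF assms(4)]] by (simp add: order_def)
  then show ?thesis
    using G.lagrange[OF subgroup_kernel] by (metis FactGroup_def dvd_triv_left partial_object.select_convs(1))
qed

section \<open>A Macdonald pair from the quaternion relations\<close>

text \<open>The pair inverts the substitution \<open>a = y inv x\<close>, \<open>b = x\<close>. Each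
  \<open>a^i b\<close> has trivial fourth power, so its \<alpha>-th power is its inverse
  \<open>a^(i+4) b\<close>; conjugation by the commutator, \<open>a^2\<close> or
  \<open>a^(-2)\<close>, also shifts \<open>i\<close> by 4 modulo 8.\<close>

lemma (in quaternion16) macdonald_pair:
  assumes "\<alpha> mod 4 = 3"
  shows "macdonald_pair G b (a \<otimes> b) \<alpha>"
proof -
  have ab: "a \<otimes> b = el 1 True"
    by (simp add: el_def)
  have cube: "el i True [^] \<alpha> = el (i + 4) True" for i
  proof -
    have pow2: "el i True [^] (2::int) = el 4 False"
      using int_pow_mult[of "el i True" 1 1] by (simp add: el_mult)
    have "el i True [^] (4::int) = el 8 False"
      using int_pow_mult[of "el i True" 2 2] by (simp add: pow2 el_mult)
    also have "\<dots> = \<one>"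
      unfolding one_eq_el by (rule el_cong) simp
    finally have "el i True [^] \<alpha> = el i True [^] (\<alpha> mod 4)"
      by (simp add: int_pow_mod)
    also have "\<dots> = el (i - 4) True"
      using int_pow_mult[of "el i True" 1 2] by (simp add: assms pow2 el_mult)
    also have "\<dots> = el (i + 4) True"
      using mod_add_self2[of "i - 4" 8] by (intro el_cong) (simp add: add.commute)
    finally show ?thesis .
  qed
  have "macdonald_pair G (el 0 True) (el 1 True) \<alpha>"
  proof
    show "inv (commut G (el 0 True) (el 1 True)) \<otimes> el 0 True \<otimes> commut G (el 0 True) (el 1 True) = el 0 True [^] \<alpha>"
      unfolding cube commut_el inv_el el_mult by simp
    show "inv (commut G (el 1 True) (el 0 True)) \<otimes> el 1 True \<otimes> commut G (el 1 True) (el 0 True) = el 1 True [^] \<alpha>"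
      unfolding cube commut_el inv_el el_mult by (simp, rule el_cong, simp)
  qed simp_all
  then show ?thesis
    by (simp only: ab b_eq_el[symmetric])
qed

definition quaternion_rels :: "(gen word \<times> gen word) set" where
  "quaternion_rels = {(word_pow wA 8, []), (word_pow wB 2, word_pow wA 4), (word_conj wA wB, word_inv wA)}"

lemma generalized_quaternion_group_4: "generalized_quaternion_group 4 = presented_group quaternion_rels"
  by (simp add: generalized_quaternion_group_def quaternion_rels_def)

lemma quaternion16_presented:
  "quaternion16 (presented_group quaternion_rels) (pres_class quaternion_rels wA) (pres_class quaternion_rels wB)"
proof -
  have rels: "pres_class quaternion_rels (word_pow wA 8) = pres_class quaternion_rels []"
    "pres_class quaternion_rels (word_pow wB 2) = pres_class quaternion_rels (word_pow wA 4)"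
    "pres_class quaternion_rels (word_conj wA wB) = pres_class quaternion_rels (word_inv wA)"
    unfolding pres_class_eq_iff by (rule pres_cong.rel; simp add: quaternion_rels_def)+
  interpret group "presented_group quaternion_rels" by (rule group_presented_group)
  have carrier: "pres_class quaternion_rels w \<in> carrier (presented_group quaternion_rels)" for w
    by (simp add: carrier_presented_group)
  have "word_pow wB 2 = wB @ wB"
    by (simp add: word_pow_def numeral_2_eq_2)
  then have "pres_class quaternion_rels wB \<otimes>\<^bsub>presented_group quaternion_rels\<^esub> pres_class quaternion_rels wB = pres_class quaternion_rels (word_pow wA 4)"
    using rels(2) by (simp only: mult_presented_group)
  moreover have "pres_class quaternion_rels (word_inv wB @ wA @ wB) = pres_class quaternion_rels (word_inv wA)"
    using rels(3) by (simp only: word_conj_def)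
  ultimately show ?thesis
    using rels(1) carrier
    by unfold_locales
      (simp_all only: int_pow_presented_group inv_presented_group mult_presented_group one_presented_group append_assoc)
qed

section \<open>The quaternion group of order 16 as a quotient of the Macdonald group\<close>

text \<open>A pair \<open>(i, s)\<close> stands for \<open>a^i b^s\<close>, and the product copies
  \<open>el_mult\<close>. This concrete model shows that the relations do not force an order below
  16.\<close>

definition q16 :: "(int \<times> bool) monoid" where
  "q16 = \<lparr>carrier = {0..<8} \<times> UNIV,
    monoid.mult = (\<lambda>(i, s) (j, t). ((i + (if s then - j else j) + (if s \<and> t then 4 else 0)) mod 8, s \<noteq> t)),
    one = (0, False)\<rparr>"

lemma group_q16: "group q16"
proof (rule groupI)
  fix x y z :: "int \<times> bool"
  obtain i s j t k v where xyz: "x = (i, s)" "y = (j, t)" "z = (k, v)"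
    by (cases x; cases y; cases z) blast
  show "x \<otimes>\<^bsub>q16\<^esub> y \<otimes>\<^bsub>q16\<^esub> z = x \<otimes>\<^bsub>q16\<^esub> (y \<otimes>\<^bsub>q16\<^esub> z)"
    unfolding xyz
    by (cases s; cases t; cases v; simp add: q16_def mod_simps; simp add: mod_eq_dvd_iff mod_simps algebra_simps;
      simp add: algebra_simps flip: minus_mult_div_eq_mod)
next
  fix x assume "x \<in> carrier q16"
  moreover obtain i s where "x = (i, s)" by fastforce
  ultimately show "\<exists>y\<in>carrier q16. y \<otimes>\<^bsub>q16\<^esub> x = \<one>\<^bsub>q16\<^esub>"
    \<comment> \<open>These are the exponents \<open>i + 4\<close> and \<open>- i\<close> of
      \<open>inv_el\<close>, brought into the range from 0 to 7.\<close>
    by (intro bexI[of _ "(if s then (if i < 4 then i + 4 else i - 4) else (if i = 0 then 0 else 8 - i), s)"])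
      (auto simp: q16_def)
qed (auto simp: q16_def)

lemma q16_pow: "(1, False) [^]\<^bsub>q16\<^esub> (n::nat) = (int n mod 8, False)"
  by (induction n) (auto simp: q16_def mod_simps add.commute)

lemma quaternion16_q16: "quaternion16 q16 (1, False) (0, True)"
proof -
  interpret group q16 by (rule group_q16)
  have inv: "inv\<^bsub>q16\<^esub> (1, False) = (7, False)" "inv\<^bsub>q16\<^esub> (0, True) = (4, True)"
    by (rule inv_equality; simp add: q16_def)+
  have "(1, False) [^]\<^bsub>q16\<^esub> (8::int) = \<one>\<^bsub>q16\<^esub>" "(1, False) [^]\<^bsub>q16\<^esub> (4::int) = (4, False)"
    using q16_pow[of 8] q16_pow[of 4] int_pow_int[of q16 "(1, False)" 8] int_pow_int[of q16 "(1, False)" 4]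
    by (simp_all add: q16_def)
  then show ?thesis
    by unfold_locales (simp_all add: inv, simp_all add: q16_def)
qed

lemma order_q16: "order q16 = 16"
  by (simp add: order_def q16_def card_cartesian_product)

lemma macdonald_rels_eval:
  assumes "macdonald_pair H (f GenA) (f GenB) \<alpha>" "(u, v) \<in> macdonald_rels \<alpha>"
  shows "word_eval H f u = word_eval H f v"
proof -
  interpret macdonald_pair H "f GenA" "f GenB" \<alpha> by fact
  have f: "f g \<in> carrier H" for g
    by (cases g) simp_all
  show ?thesis
    using assms(2) rel_x rel_y
    by (auto simp: macdonald_rels_def word_eval_conj[OF is_group f] word_eval_comm[OF is_group f]
      word_eval_pow[OF is_group f])
qed


lemma quaternion_rels_eval:
  assumes "quaternion16 H (f GenA) (f GenB)" "(u, v) \<in> quaternion_rels"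
  shows "word_eval H f u = word_eval H f v"
proof -
  interpret quaternion16 H "f GenA" "f GenB" by fact
  have f: "f g \<in> carrier H" for g
    by (cases g) simp_all
  have "f GenB [^]\<^bsub>H\<^esub> (2::int) = f GenA [^]\<^bsub>H\<^esub> (4::int)"
    using int_pow_mult[of "f GenB" 1 1] b_square by simp
  then show ?thesis
    using assms(2) a_pow_8 conj_a
    by (auto simp: quaternion_rels_def word_eval_conj[OF is_group f] word_eval_inv[OF is_group f]
      word_eval_pow[OF is_group f])
qed

section \<open>The Sylow 2-subgroup of the Macdonald group\<close>

theorem proposition8p2:
  fixes \<alpha> :: int
    and J :: "gen word set set"
    and \<pi> :: "gen word set \<Rightarrow> gen word set"
    and T :: "gen word set monoid"
    and A B C :: "gen word set"
  assumes "\<alpha> \<notin> {0, 1, 2}"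
    and "multiplicity 2 (\<alpha> - 1) = 1"
    and "sylow_subgroup 2 (macdonald_group \<alpha>) J"
    and "sylow_projection 2 (macdonald_group \<alpha>) J \<pi>"
    and "T = (macdonald_group \<alpha>)\<lparr>carrier := J\<rparr>"
    and "A = \<pi> (macdonald_A \<alpha>)"
    and "B = \<pi> (macdonald_B \<alpha>)"
    and "C = commut T A B"
  shows "T \<cong> generalized_quaternion_group 4
    \<and> center T = generate T {A [^]\<^bsub>T\<^esub> (2::nat)}
    \<and> generate T {A [^]\<^bsub>T\<^esub> (2::nat)} = lower_central T 3
    \<and> upper_central T 2 = generate T {A [^]\<^bsub>T\<^esub> (2::nat), C}
    \<and> generate T {A [^]\<^bsub>T\<^esub> (2::nat), C} = lower_central T 2
    \<and> nilpotent_of_class T 3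
    \<and> has_exponent T 8"
proof -
  \<comment> \<open>Valuation 1 means that \<alpha> - 1 is divisible by 2 but not by 4.\<close>
  have \<alpha>: "\<alpha> mod 4 = 3"
  proof -
    have "2 dvd \<alpha> - 1"
      using multiplicity_dvd[of 2 "\<alpha> - 1"] assms(2) by simp
    moreover have "\<not> 2 ^ 2 dvd \<alpha> - 1"
      using power_dvd_iff_le_multiplicity[of "\<alpha> - 1" 2 2] assms(1,2) by simp
    ultimately show ?thesis
      by (simp only: power2_eq_square) presburger
  qed
  define G where "G = macdonald_group \<alpha>"
  define R where "R = macdonald_rels \<alpha>"
  have G_R: "G = presented_group R"
    by (simp add: G_def R_def macdonald_group_def)
  interpret G: macdonald_pair G "macdonald_A \<alpha>" "macdonald_B \<alpha>" \<alpha>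
  proof -
    interpret group G
      unfolding G_R by (rule group_presented_group)
    show "macdonald_pair G (macdonald_A \<alpha>) (macdonald_B \<alpha>) \<alpha>"
      using macdonald_relations[of \<alpha>]
      by unfold_locales (simp_all add: G_def macdonald_group_def macdonald_A_def macdonald_B_def
        carrier_presented_group)
  qed
  have fin: "finite (carrier G)"
  proof -
    have gen: "pres_class R [(g, True)] = macdonald_A \<alpha> \<or> pres_class R [(g, True)] = macdonald_B \<alpha>" for g
      by (cases g) (simp_all add: R_def macdonald_A_def macdonald_B_def)
    have A_closed: "s \<otimes>\<^bsub>G\<^esub> macdonald_A \<alpha> \<in> G.normal_forms"
      "s \<otimes>\<^bsub>G\<^esub> inv\<^bsub>G\<^esub> (macdonald_A \<alpha>) \<in> G.normal_forms" if "s \<in> G.normal_forms" for s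
      using G.normal_forms_x_pow[OF that, of 1] G.normal_forms_x_pow[OF that, of "-1"]
      by (simp_all add: G.int_pow_neg)
    \<comment> \<open>The identity map serves as homomorphism, so every element of \<open>G\<close>
      is a normal form.\<close>
    have "(\<lambda>X. X) ` carrier (presented_group R) \<subseteq> G.normal_forms"
      by (rule hom_presented_group_image_subset[where H = G])
        (use gen A_closed G.normal_forms_y[OF \<alpha>] G.normal_forms_inv_y[OF \<alpha>] G.one_normal_forms in
          \<open>auto simp: G.is_group hom_def simp flip: G_R, metis+\<close>)
    then show ?thesis
      using G.finite_normal_forms[OF \<alpha>] by (simp add: G_R finite_subset)
  qed
  have J: "subgroup J G" and card_J: "card J = 2 ^ multiplicity 2 (order G)"
    using assms(3) by (simp_all add: sylow_subgroup_def G_def)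
  have T: "T = G\<lparr>carrier := J\<rparr>"
    using assms(5) by (simp add: G_def)
  have carrier_J: "carrier T = J"
    by (simp add: T)
  interpret T: group T
    unfolding T by (rule subgroup.subgroup_is_group[OF J G.is_group])
  interpret \<pi>: group_hom G T \<pi>
    using assms(4) unfolding sylow_projection_def T G_def[symmetric]
    by (intro group_hom.intro group_hom_axioms.intro G.is_group T.is_group[unfolded T]) blast
  have \<pi>_onto: "\<pi> ` carrier G = carrier T"
  proof
    have "\<pi> x = x" if "x \<in> J" for x
      using assms(4) that unfolding sylow_projection_def by blast
    then have "J \<subseteq> \<pi> ` carrier G"
      using subgroup.subset[OF J] by (metis image_eqI subset_iff)
    then show "carrier T \<subseteq> \<pi> ` carrier G"
      by (simp only: carrier_J)
  qed auto
  have \<pi>_commut: "\<pi> (commut G x y) = commut T (\<pi> x) (\<pi> y)" if "x \<in> carrier G" "y \<in> carrier G" for x y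
    using that by (simp add: commut_def)
  interpret AB: macdonald_pair T A B \<alpha>
  proof
    show "A \<in> carrier T" "B \<in> carrier T"
      by (simp_all add: assms(6,7))
    have "\<pi> (inv\<^bsub>G\<^esub> (commut G x y) \<otimes>\<^bsub>G\<^esub> x \<otimes>\<^bsub>G\<^esub> commut G x y) =
        inv\<^bsub>T\<^esub> (commut T (\<pi> x) (\<pi> y)) \<otimes>\<^bsub>T\<^esub> \<pi> x \<otimes>\<^bsub>T\<^esub> commut T (\<pi> x) (\<pi> y)"
      if "x \<in> carrier G" "y \<in> carrier G" for x y
      using that by (simp add: \<pi>_commut)
    from this[OF G.x G.y] this[OF G.y G.x]
    show "inv\<^bsub>T\<^esub> (commut T A B) \<otimes>\<^bsub>T\<^esub> A \<otimes>\<^bsub>T\<^esub> commut T A B = A [^]\<^bsub>T\<^esub> \<alpha>"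
      "inv\<^bsub>T\<^esub> (commut T B A) \<otimes>\<^bsub>T\<^esub> B \<otimes>\<^bsub>T\<^esub> commut T B A = B [^]\<^bsub>T\<^esub> \<alpha>"
      by (simp_all only: assms(6,7) G.rel_x G.rel_y \<pi>.hom_int_pow[OF G.x] \<pi>.hom_int_pow[OF G.y])
  qed
  have order_T: "order T = 2 ^ multiplicity 2 (order G)"
    using card_J by (simp add: carrier_J order_def)
  have fin_T: "finite (carrier T)"
    using fin subgroup.subset[OF J] unfolding carrier_J by (rule finite_subset[rotated])
  interpret Q: quaternion16 T "B \<otimes>\<^bsub>T\<^esub> inv\<^bsub>T\<^esub> A" A
    by (rule AB.quaternion16_if_2_group[OF \<alpha> fin_T order_T])
  have A_el: "A = Q.el 0 True" and B_el: "B = Q.el 1 True"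
    by (simp_all add: Q.el_def T.m_assoc)
  have carrier_T: "carrier T = Q.els"
  proof
    have "A \<in> Q.els" "B \<in> Q.els"
      using A_el B_el Q.el_in_els by metis+
    then have gen: "\<pi> (pres_class R [(g, True)]) \<in> Q.els" for g
      using assms(6,7) by (cases g) (simp_all add: R_def macdonald_A_def macdonald_B_def)
    have "\<pi> ` carrier (presented_group R) \<subseteq> Q.els"
      by (rule hom_presented_group_image_subset[where H = T])
        (use gen \<pi>.homh in \<open>auto simp: Q.els_closed T.is_group Q.one_eq_el simp flip: G_R\<close>)
    then show "carrier T \<subseteq> Q.els"
      using \<pi>_onto by (simp add: G_R)
  qed (auto simp: Q.els_def)
  have "16 dvd order G"
  proof -
    interpret q: quaternion16 q16 "(1, False)" "(0, True)"
      by (rule quaternion16_q16)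
    \<comment> \<open>The generators go to \<open>b\<close> and \<open>a b\<close>, the pair from
      \<open>q.macdonald_pair\<close>. The image contains \<open>a b inv b = a\<close>, so the map
      is onto.\<close>
    define f where "f g = (case g of GenA \<Rightarrow> (0, True) | GenB \<Rightarrow> (1, False) \<otimes>\<^bsub>q16\<^esub> (0, True))" for g
    have f: "f g \<in> carrier q16" for g
      by (cases g) (simp_all add: f_def)
    have "macdonald_pair q16 (f GenA) (f GenB) \<alpha>"
      using q.macdonald_pair[OF \<alpha>] by (simp add: f_def)
    then obtain h where h: "h \<in> hom (presented_group R) q16"
        and h_eval: "\<And>w. h (pres_class R w) = word_eval q16 f w"
      using von_dyck[of q16 f R] f macdonald_rels_eval q.is_group unfolding R_def by metis
    interpret h: group_hom G q16 h
      using h by (simp add: G_R group_hom_def group_hom_axioms_def group_presented_group q.is_group)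
    have "f g \<in> h ` carrier G" for g
    proof
      show "f g = h (pres_class R [(g, True)])"
        using f by (simp add: h_eval)
    qed (simp add: G_R carrier_presented_group)
    from this[of GenA] this[of GenB]
    have gens: "(0, True) \<in> h ` carrier G" "(1, False) \<otimes>\<^bsub>q16\<^esub> (0, True) \<in> h ` carrier G"
      by (simp_all add: f_def)
    interpret im: subgroup "h ` carrier G" q16
      by (rule h.img_is_subgroup)
    have "(1, False) \<otimes>\<^bsub>q16\<^esub> (0, True) \<otimes>\<^bsub>q16\<^esub> inv\<^bsub>q16\<^esub> (0, True) \<in> h ` carrier G"
      using gens by simp
    then have "(1, False) \<in> h ` carrier G"
      by (simp add: q.m_assoc)
    with gens(1) have "q.els \<subseteq> h ` carrier G"
      by (intro q.els_subset_subgroup im.subgroup_axioms)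
    moreover have "carrier q16 \<subseteq> q.els"
    proof
      fix z assume z: "z \<in> carrier q16"
      obtain i s where z_eq: "z = (i, s)" by fastforce
      have "(1, False) [^]\<^bsub>q16\<^esub> i = (i mod 8, False)"
        using z q16_pow[of "nat i"] int_pow_int[of q16 "(1, False)" "nat i"] by (simp add: z_eq q16_def)
      then have "z = q.el i s"
        using z unfolding q.el_def by (cases s) (simp_all add: z_eq q16_def)
      then show "z \<in> q.els"
        by simp
    qed
    ultimately have "h ` carrier G = carrier q16"
      using im.subset by auto
    from order_dvd_if_epi[OF G.is_group q.is_group h.homh this] show ?thesis
      by (simp add: order_q16)
  qed
  \<comment> \<open>The order of \<open>T\<close> is the 2-part of the order of \<open>G\<close>,
    hence at least 16, and \<open>els\<close> bounds it by 16 from above.\<close>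
  then have "4 \<le> multiplicity 2 (order G)"
    using fin G.order_gt_0_iff_finite power_dvd_iff_le_multiplicity[of "order G" 2 4] by simp
  then have "(2::nat) ^ 4 \<le> 2 ^ multiplicity 2 (order G)"
    by (rule power_increasing) simp
  then have card_T: "card (carrier T) = 16"
    using order_T Q.card_els_le by (simp add: order_def flip: carrier_T)
  interpret Q: quaternion16_group T "B \<otimes>\<^bsub>T\<^esub> inv\<^bsub>T\<^esub> A" A
    by unfold_locales (rule carrier_T card_T)+
  have A2: "A [^]\<^bsub>T\<^esub> (2::nat) = Q.el 4 False"
    using Q.el_mult[of 0 True 0 True] by (simp add: numeral_2_eq_2 flip: A_el)
  have C_el: "C = Q.el (- 2) False"
    using Q.commut_el[of 0 True 1 True] by (simp add: assms(8) flip: A_el B_el)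
  have gen2: "generate T {A [^]\<^bsub>T\<^esub> (2::nat), C} = Q.rot 2"
  proof
    show "generate T {A [^]\<^bsub>T\<^esub> (2::nat), C} \<subseteq> Q.rot 2"
      by (intro T.generate_subgroup_incl Q.subgroup_rot) (simp add: A2 C_el Q.el_in_rot_iff)
    \<comment> \<open>\<open>C\<close> is \<open>a^(-2)\<close>, which generates the same subgroup
      as \<open>a^2\<close>.\<close>
    have "Q.rot (- 2) \<subseteq> generate T {A [^]\<^bsub>T\<^esub> (2::nat), C}"
      unfolding Q.rot_eq_generate by (intro T.mono_generate) (simp add: C_el)
    moreover have "Q.rot 2 \<subseteq> Q.rot (- 2)"
      unfolding Q.rot_eq_generate[of 2] by (intro T.generate_subgroup_incl Q.subgroup_rot) (simp add: Q.el_in_rot_iff)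
    ultimately show "Q.rot 2 \<subseteq> generate T {A [^]\<^bsub>T\<^esub> (2::nat), C}"
      by blast
  qed
  have gen4: "generate T {A [^]\<^bsub>T\<^esub> (2::nat)} = Q.rot 4"
    by (simp add: A2 Q.rot_eq_generate)
  have iso: "T \<cong> generalized_quaternion_group 4"
  proof -
    let ?M = "presented_group quaternion_rels"
    interpret M: quaternion16 ?M "pres_class quaternion_rels wA" "pres_class quaternion_rels wB"
      by (rule quaternion16_presented)
    have gen: "pres_class quaternion_rels [(g, True)] \<in> M.els" for g
      by (cases g) (metis M.a_eq_el M.b_eq_el M.el_in_els)+
    have "(\<lambda>X. X) ` carrier ?M \<subseteq> M.els"
      by (rule hom_presented_group_image_subset[where H = ?M])
        (use gen in \<open>auto simp: M.els_closed M.is_group M.one_eq_el hom_def\<close>)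
    then have M_els: "carrier ?M = M.els"
      by (auto simp: M.els_def)
    define f where "f g = (case g of GenA \<Rightarrow> B \<otimes>\<^bsub>T\<^esub> inv\<^bsub>T\<^esub> A | GenB \<Rightarrow> A)" for g
    have f: "f g \<in> carrier T" for g
      by (cases g) (simp_all add: f_def)
    have "quaternion16 T (f GenA) (f GenB)"
      using Q.quaternion16_axioms by (simp add: f_def)
    then obtain h where h: "h \<in> hom ?M T"
        and h_eval: "\<And>w. h (pres_class quaternion_rels w) = word_eval T f w"
      using von_dyck[of T f quaternion_rels] f quaternion_rels_eval T.is_group by metis
    interpret h: group_hom ?M T h
      using h by (simp add: group_hom_def group_hom_axioms_def M.is_group T.is_group)
    have "f g \<in> h ` carrier ?M" for g
    proof
      show "f g = h (pres_class quaternion_rels [(g, True)])"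
        using f by (simp add: h_eval)
    qed (simp add: carrier_presented_group)
    from this[of GenA] this[of GenB] have "Q.els \<subseteq> h ` carrier ?M"
      by (intro Q.els_subset_subgroup h.img_is_subgroup) (simp_all add: f_def)
    then have onto: "h ` carrier ?M = carrier T"
      using carrier_T by auto
    have fin_M: "finite (carrier ?M)"
      by (simp add: M_els M.finite_els)
    \<comment> \<open>The presented group has at most 16 elements and is mapped onto the 16 elements
      of \<open>T\<close>, so \<open>h\<close> is injective.\<close>
    have "card (carrier ?M) \<le> card (h ` carrier ?M)"
      unfolding onto card_T using M.card_els_le by (simp only: M_els)
    then have "inj_on h (carrier ?M)"
      using fin_M card_image_le[OF fin_M, of h] by (intro eq_card_imp_inj_on) auto
    then have "?M \<cong> T"
      using h onto by (intro is_isoI[of h] isoI) (simp_all add: bij_betw_def)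
    then show ?thesis
      by (simp add: generalized_quaternion_group_4 M.iso_sym)
  qed
  show ?thesis
    using iso Q.center Q.lower_central_3 Q.upper_central_2 Q.lower_central_2 Q.nilpotent_of_class_3
      Q.has_exponent_8 gen2 gen4 by simp
qed

end
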